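(* Let $\mathcal H_k$ be a reproducing kernel Hilbert space of analytic functions on the unit disc $\mathbb D$, with reproducing kernel $k$, such that (i) $M_z$ (multiplication by the identity function) is contractive on $\mathcal H_k$, (ii) $k(z,z)\to\infty$ as $|z|\to1^-$. Let $b\in\mathrm{Mult}(\mathcal H_k)$ be non-constant and contractive (i.e. $\|M_b\|\le1$). Then the inclusion map from $\mathcal H_k(b)$ into $\mathcal H_k$ is compact if and only if $I-M_zM_z^*$ is compact and $b$ is a finite Blaschke product.
   Context: $\mathrm{Mult}(\mathcal H_k)$ is the set of functions $\phi$ on $\mathbb D$ with $\phi f\in\mathcal H_k$ for all $f\in\mathcal H_k$, and $M_\phi f=\phi f$ is the corresponding bounded operator on $\mathcal H_k$. For $b\in\mathrm{Mult}(\mathcal H_k)$ with $\|M_b\|\le1$, $\mathcal H_k(b)$ denotes the Hilbert function space on $\mathbb D$ with reproducing kernel $k(z,w)(1-b(z)\overline{b(w)})$; it is contractively contained in $\mathcal H_k$.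
   Formalization: The multiplier b is additionally assumed analytic on the disc; this is automatic when k(z,z) is never 0, but at common zeros of H_k the value of b is arbitrary and the literal claim fails (H_k = zH², b(z)=z for z≠0, b(0)=1/2). *)

theory Defs
  imports "HOL-Complex_Analysis.Complex_Analysis"
begin

text \<open>A complex inner product space of functions on a set \<open>S\<close>. A function on \<open>S\<close> is represented by
  its extension by zero to the whole type, so that equality of elements is equality on \<open>S\<close>.
  The inner product is linear in the first argument.\<close>

record 'x fun_space =
  elts :: "('x \<Rightarrow> complex) set"
  inn :: "('x \<Rightarrow> complex) \<Rightarrow> ('x \<Rightarrow> complex) \<Rightarrow> complex"

definition fnorm :: "'x fun_space \<Rightarrow> ('x \<Rightarrow> complex) \<Rightarrow> real" where
  "fnorm H f = sqrt (Re (inn H f f))"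

definition converges_in ::
    "'x fun_space \<Rightarrow> (nat \<Rightarrow> 'x \<Rightarrow> complex) \<Rightarrow> ('x \<Rightarrow> complex) \<Rightarrow> bool" where
  "converges_in H F f \<longleftrightarrow> f \<in> elts H \<and> (\<lambda>n. fnorm H (\<lambda>x. F n x - f x)) \<longlonglongrightarrow> 0"

locale hilbert_function_space =
  fixes S :: "'x set" and H :: "'x fun_space"
  assumes supported: "f \<in> elts H \<Longrightarrow> x \<notin> S \<Longrightarrow> f x = 0"
    and zero_mem: "(\<lambda>x. 0) \<in> elts H"
    and add_mem: "f \<in> elts H \<Longrightarrow> g \<in> elts H \<Longrightarrow> (\<lambda>x. f x + g x) \<in> elts H"
    and scale_mem: "f \<in> elts H \<Longrightarrow> (\<lambda>x. c * f x) \<in> elts H"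
    and inn_add: "f \<in> elts H \<Longrightarrow> g \<in> elts H \<Longrightarrow> h \<in> elts H \<Longrightarrow>
      inn H (\<lambda>x. f x + g x) h = inn H f h + inn H g h"
    and inn_scale: "f \<in> elts H \<Longrightarrow> g \<in> elts H \<Longrightarrow> inn H (\<lambda>x. c * f x) g = c * inn H f g"
    and inn_commute: "f \<in> elts H \<Longrightarrow> g \<in> elts H \<Longrightarrow> inn H g f = cnj (inn H f g)"
    and inn_nonneg: "f \<in> elts H \<Longrightarrow> 0 \<le> Re (inn H f f)"
    and inn_eq_zero: "f \<in> elts H \<Longrightarrow> inn H f f = 0 \<Longrightarrow> f = (\<lambda>x. 0)"
    and complete: "(\<And>n. F n \<in> elts H) \<Longrightarrow>
      (\<And>e. e > 0 \<Longrightarrow> \<exists>N. \<forall>m\<ge>N. \<forall>n\<ge>N. fnorm H (\<lambda>x. F m x - F n x) < e) \<Longrightarrow>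
      \<exists>f. converges_in H F f"

text \<open>Boundedness of the point evaluations is not listed separately: it follows from the
  reproducing property by the Cauchy--Schwarz inequality. Only the values of \<open>k\<close> on
  \<open>S \<times> S\<close> matter.\<close>

locale rkhs = hilbert_function_space S H for S :: "'x set" and H :: "'x fun_space" +
  fixes k :: "'x \<Rightarrow> 'x \<Rightarrow> complex"
  assumes kernel_mem: "w \<in> S \<Longrightarrow> (\<lambda>z. if z \<in> S then k z w else 0) \<in> elts H"
    and reproducing: "w \<in> S \<Longrightarrow> f \<in> elts H \<Longrightarrow>
      f w = inn H f (\<lambda>z. if z \<in> S then k z w else 0)"

definition mult_op :: "('x \<Rightarrow> complex) \<Rightarrow> ('x \<Rightarrow> complex) \<Rightarrow> 'x \<Rightarrow> complex" where
  "mult_op \<phi> f = (\<lambda>x. \<phi> x * f x)"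

text \<open>The operator \<open>mult_op \<phi>\<close> does not see \<open>\<phi>\<close> at a common zero of all elements of the space, so
  membership in \<open>Mult H\<close> forces \<open>\<phi>\<close> to be analytic only away from the common zeros of a space of
  analytic functions.\<close>

definition Mult :: "'x fun_space \<Rightarrow> ('x \<Rightarrow> complex) set" where
  "Mult H = {\<phi>. \<forall>f\<in>elts H. mult_op \<phi> f \<in> elts H}"

definition contractive_on ::
    "'x fun_space \<Rightarrow> (('x \<Rightarrow> complex) \<Rightarrow> ('x \<Rightarrow> complex)) \<Rightarrow> bool" where
  "contractive_on H T \<longleftrightarrow> (\<forall>f\<in>elts H. fnorm H (T f) \<le> fnorm H f)"

text \<open>On a Hilbert space the adjoint of a bounded operator is well defined, by the Riesz
  representation theorem.\<close>

definition adjoint_op ::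
    "'x fun_space \<Rightarrow> (('x \<Rightarrow> complex) \<Rightarrow> ('x \<Rightarrow> complex)) \<Rightarrow> ('x \<Rightarrow> complex) \<Rightarrow> 'x \<Rightarrow> complex" where
  "adjoint_op H T g = (THE h. h \<in> elts H \<and> (\<forall>f\<in>elts H. inn H (T f) g = inn H f h))"

definition linear_between ::
    "'x fun_space \<Rightarrow> 'x fun_space \<Rightarrow> (('x \<Rightarrow> complex) \<Rightarrow> ('x \<Rightarrow> complex)) \<Rightarrow> bool" where
  "linear_between H1 H2 T \<longleftrightarrow>
     (\<forall>f\<in>elts H1. T f \<in> elts H2) \<and>
     (\<forall>f\<in>elts H1. \<forall>g\<in>elts H1. T (\<lambda>x. f x + g x) = (\<lambda>x. T f x + T g x)) \<and>
     (\<forall>f\<in>elts H1. \<forall>c. T (\<lambda>x. c * f x) = (\<lambda>x. c * T f x))"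

definition compact_operator ::
    "'x fun_space \<Rightarrow> 'x fun_space \<Rightarrow> (('x \<Rightarrow> complex) \<Rightarrow> ('x \<Rightarrow> complex)) \<Rightarrow> bool" where
  "compact_operator H1 H2 T \<longleftrightarrow> linear_between H1 H2 T \<and>
     (\<forall>F :: nat \<Rightarrow> 'x \<Rightarrow> complex. \<forall>C. (\<forall>n. F n \<in> elts H1 \<and> fnorm H1 (F n) \<le> C) \<longrightarrow>
        (\<exists>(r :: nat \<Rightarrow> nat) g. strict_mono r \<and> converges_in H2 (\<lambda>n. T (F (r n))) g))"

text \<open>The list holds the zeros, repeated according to multiplicity.\<close>

definition finite_blaschke_product :: "(complex \<Rightarrow> complex) \<Rightarrow> bool" where
  "finite_blaschke_product b \<longleftrightarrow>
     (\<exists>c as. cmod c = 1 \<and> set as \<subseteq> ball 0 1 \<and>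
        (\<forall>z\<in>ball 0 1. b z = c * (\<Prod>a\<leftarrow>as. (z - a) / (1 - cnj a * z))))"

end

theory Submission
  imports Defs
begin

text \<open>For a contraction \<open>T\<close> consider the quadratic form
  \<open>q\<^sub>T(f) = \<parallel>f\<parallel>\<^sup>2 - \<parallel>T\<^sup>* f\<parallel>\<^sup>2\<close> of \<open>I - T T\<^sup>*\<close>. If \<open>J\<close> is the inclusion of \<open>H\<^sub>b\<close> in \<open>H\<close>, then
  \<open>J J\<^sup>* = I - M\<^sub>b M\<^sub>b\<^sup>*\<close>, so \<open>J\<close> is compact iff the form of \<open>M\<^sub>b\<close> is.

  The form of a product \<open>T U\<close> is \<open>q\<^sub>T(f) + q\<^sub>U(T\<^sup>* f)\<close>, and for a Moebius factor \<open>\<phi>\<close> with zero \<open>a\<close>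
  one has \<open>q\<^sub>\<phi>(u - a M\<^sub>z\<^sup>* u) = (1 - |a|\<^sup>2) q\<^sub>z(u)\<close>, where \<open>I - a M\<^sub>z\<^sup>*\<close> is invertible. Hence for a
  non-constant finite Blaschke product \<open>b\<close> the form of \<open>M\<^sub>b\<close> is compact iff that of \<open>M\<^sub>z\<close> is.

  It remains to see that compactness of \<open>J\<close> forces \<open>b\<close> to be a finite Blaschke product. Let \<open>e\<^sub>w\<close> be
  the normalized kernel at \<open>w\<close>. Then \<open>\<langle>(I - M\<^sub>b M\<^sub>b\<^sup>*) e\<^sub>w, e\<^sub>w\<rangle> = 1 - |b(w)|\<^sup>2\<close>, and
  \<open>e\<^sub>w\<close> tends weakly to \<open>0\<close> as \<open>w\<close> tends to a point \<open>\<zeta>\<close> of the circle, because the range of \<open>M\<^sub>z - \<zeta>\<close>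
  is dense. Therefore \<open>|b(w)|\<close> tends to \<open>1\<close> at the circle, and the maximum principle
  applies after dividing out the zeros of \<open>b\<close>.\<close>

section \<open>Hilbert function spaces\<close>

context hilbert_function_space
begin

section \<open>Sesquilinearity, norm identities and the Cauchy-Schwarz inequality\<close>

lemmas [simp] = zero_mem add_mem scale_mem inn_add inn_scale

lemma uminus_mem [simp]: "f \<in> elts H \<Longrightarrow> (\<lambda>x. - f x) \<in> elts H"
  using scale_mem[of f "-1"] by simp

lemma diff_mem [simp]: "f \<in> elts H \<Longrightarrow> g \<in> elts H \<Longrightarrow> (\<lambda>x. f x - g x) \<in> elts H"
  using add_mem[OF _ uminus_mem, of f g] by simp

lemma inn_uminus [simp]: "f \<in> elts H \<Longrightarrow> g \<in> elts H \<Longrightarrow> inn H (\<lambda>x. - f x) g = - inn H f g"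
  using inn_scale[of f g "-1"] by simp

lemma inn_diff [simp]:
  "f \<in> elts H \<Longrightarrow> g \<in> elts H \<Longrightarrow> h \<in> elts H \<Longrightarrow>
    inn H (\<lambda>x. f x - g x) h = inn H f h - inn H g h"
  using inn_add[OF _ uminus_mem, of f g h] by simp

lemma inn_zero [simp]: "f \<in> elts H \<Longrightarrow> inn H (\<lambda>x. 0) f = 0"
  using inn_scale[of f f 0] by simp

lemma inn_add_right [simp]:
  assumes "f \<in> elts H" "g \<in> elts H" "h \<in> elts H"
  shows "inn H h (\<lambda>x. f x + g x) = inn H h f + inn H h g"
  using assms inn_commute[of "\<lambda>x. f x + g x" h] inn_commute[of f h] inn_commute[of g h] by simp

lemma inn_scale_right [simp]:
  assumes "f \<in> elts H" "h \<in> elts H"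
  shows "inn H h (\<lambda>x. c * f x) = cnj c * inn H h f"
  using assms inn_commute[of "\<lambda>x. c * f x" h] inn_commute[of f h] by simp

lemma inn_diff_right [simp]:
  assumes "f \<in> elts H" "g \<in> elts H" "h \<in> elts H"
  shows "inn H h (\<lambda>x. f x - g x) = inn H h f - inn H h g"
  using assms inn_commute[of "\<lambda>x. f x - g x" h] inn_commute[of f h] inn_commute[of g h] by simp

lemma inn_zero_right [simp]: "f \<in> elts H \<Longrightarrow> inn H f (\<lambda>x. 0) = 0"
  using inn_commute[of "\<lambda>x. 0" f] by simp

lemma fnorm_nonneg [simp]: "f \<in> elts H \<Longrightarrow> 0 \<le> fnorm H f"
  unfolding fnorm_def using inn_nonneg by simp

lemma fnorm_power2: "f \<in> elts H \<Longrightarrow> (fnorm H f)\<^sup>2 = Re (inn H f f)"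
  unfolding fnorm_def using inn_nonneg by simp

lemma inn_self: "f \<in> elts H \<Longrightarrow> inn H f f = of_real ((fnorm H f)\<^sup>2)"
  using inn_commute[of f f] by (simp add: complex_eq_iff fnorm_power2)

lemma fnorm_eq_zero: "f \<in> elts H \<Longrightarrow> fnorm H f = 0 \<Longrightarrow> f = (\<lambda>x. 0)"
  using inn_self[of f] inn_eq_zero[of f] by simp

lemma fnorm_zero [simp]: "fnorm H (\<lambda>x. 0) = 0"
  using inn_zero[OF zero_mem] by (simp add: fnorm_def)

lemma fnorm_scale: "f \<in> elts H \<Longrightarrow> fnorm H (\<lambda>x. c * f x) = cmod c * fnorm H f"
proof -
  assume f: "f \<in> elts H"
  have "(fnorm H (\<lambda>x. c * f x))\<^sup>2 = Re (c * (cnj c * inn H f f))"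
    using f by (simp add: fnorm_power2 del: of_real_power)
  also have "\<dots> = (cmod c)\<^sup>2 * (fnorm H f)\<^sup>2"
    unfolding inn_self[OF f] mult.assoc[symmetric] complex_norm_square[symmetric] by simp
  finally show ?thesis
    using f by (subst power2_eq_iff_nonneg[symmetric]) (auto simp: power_mult_distrib)
qed

lemma fnorm_add_power2:
  assumes "f \<in> elts H" "g \<in> elts H"
  shows "(fnorm H (\<lambda>x. f x + g x))\<^sup>2 = (fnorm H f)\<^sup>2 + 2 * Re (inn H f g) + (fnorm H g)\<^sup>2"
  using assms inn_commute[of f g] by (simp add: fnorm_power2)

lemma fnorm_diff_power2:
  assumes "f \<in> elts H" "g \<in> elts H"
  shows "(fnorm H (\<lambda>x. f x - g x))\<^sup>2 = (fnorm H f)\<^sup>2 - 2 * Re (inn H f g) + (fnorm H g)\<^sup>2"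
  using assms inn_commute[of f g] by (simp add: fnorm_power2)

lemma parallelogram:
  assumes "f \<in> elts H" "g \<in> elts H"
  shows "(fnorm H (\<lambda>x. f x + g x))\<^sup>2 + (fnorm H (\<lambda>x. f x - g x))\<^sup>2
    = 2 * (fnorm H f)\<^sup>2 + 2 * (fnorm H g)\<^sup>2"
  using fnorm_add_power2[OF assms] fnorm_diff_power2[OF assms] by simp

lemma fnorm_minus_commute:
  "f \<in> elts H \<Longrightarrow> g \<in> elts H \<Longrightarrow> fnorm H (\<lambda>x. f x - g x) = fnorm H (\<lambda>x. g x - f x)"
  using fnorm_scale[of "\<lambda>x. f x - g x" "-1"] by simp

text \<open>Test the lower bound \<open>d\<close> at the point of the line spanned by
  \<open>u\<close> that is nearest to \<open>f\<close>. The case \<open>d = 0\<close> is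
  Cauchy-Schwarz; with \<open>d\<close> an infimum over a subspace, near-minimizers become nearly
  orthogonal to \<open>u\<close>.\<close>

lemma inn_bound_of_min:
  assumes f: "f \<in> elts H" and u: "u \<in> elts H"
    and min: "\<And>c. d \<le> (fnorm H (\<lambda>x. f x - c * u x))\<^sup>2"
  shows "(cmod (inn H f u))\<^sup>2 \<le> (fnorm H u)\<^sup>2 * ((fnorm H f)\<^sup>2 - d)"
proof (cases "fnorm H u = 0")
  case True
  then have "u = (\<lambda>x. 0)" using fnorm_eq_zero u by blast
  then show ?thesis using f by simp
next
  case False
  then have pos: "(fnorm H u)\<^sup>2 > 0" by simp
  \<comment> \<open>The coefficient of the orthogonal projection of \<open>f\<close> onto
    \<open>u\<close>.\<close>
  define c where "c = inn H f u / of_real ((fnorm H u)\<^sup>2)"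
  have c: "cmod c = cmod (inn H f u) / (fnorm H u)\<^sup>2"
    by (simp add: c_def norm_divide norm_power)
  have "d \<le> (fnorm H f)\<^sup>2 - 2 * Re (cnj c * inn H f u) + (cmod c * fnorm H u)\<^sup>2"
    using min[of c] fnorm_diff_power2[of f "\<lambda>x. c * u x"] fnorm_scale[of u c] f u by simp
  also have "cnj c * inn H f u = of_real ((cmod (inn H f u))\<^sup>2 / (fnorm H u)\<^sup>2)"
    unfolding c_def by (simp add: complex_norm_square[unfolded of_real_power] mult.commute)
  also have "(cmod c * fnorm H u)\<^sup>2 = (cmod (inn H f u))\<^sup>2 / (fnorm H u)\<^sup>2"
    using pos unfolding c by (simp add: field_simps power2_eq_square)
  finally have "(cmod (inn H f u))\<^sup>2 / (fnorm H u)\<^sup>2 \<le> (fnorm H f)\<^sup>2 - d" by simp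
  then show ?thesis using pos by (simp add: field_simps)
qed

lemma Cauchy_Schwarz:
  assumes "f \<in> elts H" "g \<in> elts H"
  shows "cmod (inn H f g) \<le> fnorm H f * fnorm H g"
proof (rule power2_le_imp_le)
  show "(cmod (inn H f g))\<^sup>2 \<le> (fnorm H f * fnorm H g)\<^sup>2"
    using inn_bound_of_min[OF assms, of 0] by (simp add: power_mult_distrib mult.commute)
qed (use assms in simp)

lemma fnorm_triangle:
  assumes "f \<in> elts H" "g \<in> elts H"
  shows "fnorm H (\<lambda>x. f x + g x) \<le> fnorm H f + fnorm H g"
proof (rule power2_le_imp_le)
  have "Re (inn H f g) \<le> fnorm H f * fnorm H g"
    using Cauchy_Schwarz[OF assms] complex_Re_le_cmod order_trans by blast
  then show "(fnorm H (\<lambda>x. f x + g x))\<^sup>2 \<le> (fnorm H f + fnorm H g)\<^sup>2"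
    using assms by (simp add: fnorm_add_power2 power2_sum)
qed (use assms in simp)

lemma fnorm_triangle_diff:
  assumes "f \<in> elts H" "g \<in> elts H"
  shows "fnorm H (\<lambda>x. f x - g x) \<le> fnorm H f + fnorm H g"
  using fnorm_triangle[of f "\<lambda>x. - g x"] fnorm_scale[of g "-1"] assms by simp

lemma inn_tendsto:
  assumes F: "\<And>n. F n \<in> elts H" and conv: "converges_in H F f" and g: "g \<in> elts H"
  shows "(\<lambda>n. inn H (F n) g) \<longlonglongrightarrow> inn H f g"
proof -
  have f: "f \<in> elts H" and lim: "(\<lambda>n. fnorm H (\<lambda>x. F n x - f x)) \<longlonglongrightarrow> 0"
    using conv by (auto simp: converges_in_def)
  have "(\<lambda>n. inn H (F n) g - inn H f g) \<longlonglongrightarrow> 0"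
  proof (rule Lim_null_comparison)
    show "\<forall>\<^sub>F n in sequentially.
        norm (inn H (F n) g - inn H f g) \<le> fnorm H (\<lambda>x. F n x - f x) * fnorm H g"
      using Cauchy_Schwarz[of "\<lambda>x. F _ x - f x" g] F f g by (intro always_eventually) simp
    show "(\<lambda>n. fnorm H (\<lambda>x. F n x - f x) * fnorm H g) \<longlonglongrightarrow> 0"
      using tendsto_mult_right[OF lim, of "fnorm H g"] by simp
  qed
  then show ?thesis by (simp add: LIM_zero_iff)
qed

lemma converges_in_Cauchy:
  assumes F: "\<And>n. F n \<in> elts H" and conv: "converges_in H F f" and "e > 0"
  shows "\<exists>N. \<forall>m\<ge>N. \<forall>n\<ge>N. fnorm H (\<lambda>x. F m x - F n x) < e"
proof -
  have f: "f \<in> elts H" and lim: "(\<lambda>n. fnorm H (\<lambda>x. F n x - f x)) \<longlonglongrightarrow> 0"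
    using conv by (auto simp: converges_in_def)
  from lim have "\<forall>\<^sub>F n in sequentially. fnorm H (\<lambda>x. F n x - f x) < e / 2"
    using \<open>e > 0\<close> by (auto dest: order_tendstoD(2)[of _ _ _ "e/2"])
  then obtain N where N: "\<And>n. n \<ge> N \<Longrightarrow> fnorm H (\<lambda>x. F n x - f x) < e / 2"
    by (auto simp: eventually_sequentially)
  have "fnorm H (\<lambda>x. F m x - F n x) < e" if "m \<ge> N" "n \<ge> N" for m n
    using fnorm_triangle_diff[of "\<lambda>x. F m x - f x" "\<lambda>x. F n x - f x"] F f N[OF that(1)] N[OF that(2)]
    by simp
  then show ?thesis by blast
qed

section \<open>Orthogonal projection and Riesz representation\<close>

lemma projection:
  assumes V: "V \<subseteq> elts H" "(\<lambda>x. 0) \<in> V"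
    and V_add: "\<And>f g. f \<in> V \<Longrightarrow> g \<in> V \<Longrightarrow> (\<lambda>x. f x + g x) \<in> V"
    and V_scale: "\<And>f c. f \<in> V \<Longrightarrow> (\<lambda>x. c * f x) \<in> V"
    and f: "f \<in> elts H"
  obtains v p where "\<And>n. v n \<in> V" "converges_in H v p" "\<And>u. u \<in> V \<Longrightarrow> inn H (\<lambda>x. f x - p x) u = 0"
proof -
  \<comment> \<open>\<open>V\<close> need not be closed, so \<open>p\<close> lies in its closure and
    is returned together with a minimizing sequence in \<open>V\<close>.\<close>
  define D where "D = (\<lambda>v. (fnorm H (\<lambda>x. f x - v x))\<^sup>2) ` V"
  define d where "d = Inf D"
  have "bdd_below D" by (rule bdd_belowI[of _ 0]) (auto simp: D_def)
  then have d: "d \<le> (fnorm H (\<lambda>x. f x - v x))\<^sup>2" if "v \<in> V" for v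
    unfolding d_def using that by (intro cInf_lower) (auto simp: D_def)
  have "D \<noteq> {}" using V by (auto simp: D_def)
  then have "\<exists>v\<in>V. (fnorm H (\<lambda>x. f x - v x))\<^sup>2 < d + 1 / real (Suc n)" for n
    using cInf_lessD[of D "d + 1 / real (Suc n)"] by (auto simp: d_def D_def)
  then obtain v where vV: "\<And>n. v n \<in> V"
    and v: "\<And>n. (fnorm H (\<lambda>x. f x - v n x))\<^sup>2 < d + 1 / real (Suc n)" by metis
  have vE: "v n \<in> elts H" for n using vV V by blast
  have lim1: "(\<lambda>n. 1 / real (Suc n)) \<longlonglongrightarrow> 0"
    using LIMSEQ_inverse_real_of_nat by (simp add: inverse_eq_divide)
  \<comment> \<open>The midpoint of \<open>v m\<close> and \<open>v n\<close> lies in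
    \<open>V\<close>, so its squared distance to \<open>f\<close> is at least \<open>d\<close>; the
    parallelogram law then makes the minimizing sequence Cauchy.\<close>
  have diff: "(fnorm H (\<lambda>x. v m x - v n x))\<^sup>2 \<le> 2 / real (Suc m) + 2 / real (Suc n)" for m n
  proof -
    have mid: "(\<lambda>x. (1/2) * (v m x + v n x)) \<in> V" using V_scale V_add vV by blast
    have E: "(\<lambda>x. v m x + v n x) \<in> elts H" using vE by simp
    have "(\<lambda>x. (f x - v m x) + (f x - v n x)) = (\<lambda>x. 2 * (f x - (1/2) * (v m x + v n x)))"
      by (simp add: fun_eq_iff algebra_simps)
    then have "fnorm H (\<lambda>x. (f x - v m x) + (f x - v n x))
        = cmod 2 * fnorm H (\<lambda>x. f x - (1/2) * (v m x + v n x))"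
      by (simp only:) (rule fnorm_scale, intro diff_mem scale_mem f E)
    then have "(fnorm H (\<lambda>x. (f x - v m x) + (f x - v n x)))\<^sup>2 \<ge> 4 * d"
      using d[OF mid] by (simp add: power_mult_distrib)
    moreover have "fnorm H (\<lambda>x. (f x - v m x) - (f x - v n x)) = fnorm H (\<lambda>x. v m x - v n x)"
      using fnorm_minus_commute[OF vE vE, of m n] by simp
    ultimately show ?thesis
      using parallelogram[of "\<lambda>x. f x - v m x" "\<lambda>x. f x - v n x"] v[of m] v[of n] f vE by simp
  qed
  have "\<exists>p. converges_in H v p"
  proof (rule complete[OF vE])
    fix e :: real assume "e > 0"
    then have "\<forall>\<^sub>F n in sequentially. 1 / real (Suc n) < e\<^sup>2 / 4"
      using order_tendstoD(2)[OF lim1, of "e\<^sup>2 / 4"] by simp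
    then obtain N where N: "\<And>n. n \<ge> N \<Longrightarrow> 1 / real (Suc n) < e\<^sup>2 / 4"
      by (auto simp: eventually_sequentially)
    have "fnorm H (\<lambda>x. v m x - v n x) < e" if "m \<ge> N" "n \<ge> N" for m n
    proof (rule power2_less_imp_less)
      show "(fnorm H (\<lambda>x. v m x - v n x))\<^sup>2 < e\<^sup>2"
        using diff[of m n] N[OF that(1)] N[OF that(2)] by simp
    qed (use \<open>e > 0\<close> in simp)
    then show "\<exists>N. \<forall>m\<ge>N. \<forall>n\<ge>N. fnorm H (\<lambda>x. v m x - v n x) < e" by blast
  qed
  then obtain p where p: "converges_in H v p" by blast
  then have pE: "p \<in> elts H" by (simp add: converges_in_def)
  have "inn H (\<lambda>x. f x - p x) u = 0" if u: "u \<in> V" for u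
  proof -
    have uE: "u \<in> elts H" using u V by blast
    \<comment> \<open>Moving from \<open>v n\<close> along \<open>u\<close> stays in
      \<open>V\<close>, so the squared distance to \<open>f\<close> never drops below
      \<open>d\<close>, while at \<open>v n\<close> it exceeds \<open>d\<close> by less than
      \<open>1 / Suc n\<close>.\<close>
    have bound: "(cmod (inn H (\<lambda>x. f x - v n x) u))\<^sup>2 \<le> (fnorm H u)\<^sup>2 * (1 / real (Suc n))" for n
    proof -
      have "d \<le> (fnorm H (\<lambda>x. (f x - v n x) - c * u x))\<^sup>2" for c
        using d[of "\<lambda>x. v n x + c * u x"] V_add[OF vV V_scale[OF u], of n c]
        by (simp add: diff_diff_eq)
      then have "(cmod (inn H (\<lambda>x. f x - v n x) u))\<^sup>2
          \<le> (fnorm H u)\<^sup>2 * ((fnorm H (\<lambda>x. f x - v n x))\<^sup>2 - d)"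
        using f uE vE by (intro inn_bound_of_min) auto
      also have "\<dots> \<le> (fnorm H u)\<^sup>2 * (1 / real (Suc n))"
        using v[of n] by (intro mult_left_mono) auto
      finally show ?thesis .
    qed
    have "(\<lambda>n. (cmod (inn H (\<lambda>x. f x - v n x) u))\<^sup>2) \<longlonglongrightarrow> (cmod (inn H (\<lambda>x. f x - p x) u))\<^sup>2"
      using inn_tendsto[OF vE p uE] f uE vE pE by (simp, intro tendsto_intros)
    moreover have "(\<lambda>n. (fnorm H u)\<^sup>2 * (1 / real (Suc n))) \<longlonglongrightarrow> 0"
      using tendsto_mult_left[OF lim1, of "(fnorm H u)\<^sup>2"] by simp
    ultimately have "(cmod (inn H (\<lambda>x. f x - p x) u))\<^sup>2 \<le> 0"
      using bound by (blast intro: LIMSEQ_le)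
    then show ?thesis by simp
  qed
  then show ?thesis using that vV p by blast
qed

text \<open>The residual \<open>f - p\<close> of the projection is orthogonal to \<open>V\<close>,
  hence zero, so the minimizing sequence converges to \<open>f\<close> itself.\<close>

lemma dense_if_orthogonal_trivial:
  assumes V: "V \<subseteq> elts H" "(\<lambda>x. 0) \<in> V"
    and V_add: "\<And>f g. f \<in> V \<Longrightarrow> g \<in> V \<Longrightarrow> (\<lambda>x. f x + g x) \<in> V"
    and V_scale: "\<And>f c. f \<in> V \<Longrightarrow> (\<lambda>x. c * f x) \<in> V"
    and triv: "\<And>h. h \<in> elts H \<Longrightarrow> (\<And>u. u \<in> V \<Longrightarrow> inn H h u = 0) \<Longrightarrow> h = (\<lambda>x. 0)"
    and f: "f \<in> elts H"
  obtains v where "\<And>n. v n \<in> V" "converges_in H v f"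
proof -
  obtain v p where v: "\<And>n. v n \<in> V" "converges_in H v p"
    and p: "\<And>u. u \<in> V \<Longrightarrow> inn H (\<lambda>x. f x - p x) u = 0"
    using projection[OF V V_add V_scale f] by blast
  then have "p \<in> elts H" by (simp add: converges_in_def)
  then have "(\<lambda>x. f x - p x) = (\<lambda>x. 0)" using triv p f by simp
  then have "p = f" by (simp add: fun_eq_iff)
  then show ?thesis using that v by blast
qed

text \<open>The representing vector is a multiple of \<open>u = f - p\<close>, where
  \<open>L f\<close> is nonzero and \<open>p\<close> is the projection of \<open>f\<close> onto the
  kernel of \<open>L\<close>. Boundedness of \<open>L\<close> keeps \<open>p\<close> in that
  kernel.\<close>

lemma Riesz:
  assumes add: "\<And>f g. f \<in> elts H \<Longrightarrow> g \<in> elts H \<Longrightarrow> L (\<lambda>x. f x + g x) = L f + L g"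
    and scale: "\<And>f c. f \<in> elts H \<Longrightarrow> L (\<lambda>x. c * f x) = c * L f"
    and bound: "\<And>f. f \<in> elts H \<Longrightarrow> cmod (L f) \<le> C * fnorm H f"
  obtains h where "h \<in> elts H" "\<And>f. f \<in> elts H \<Longrightarrow> L f = inn H f h"
proof (cases "\<forall>f\<in>elts H. L f = 0")
  case True
  then show ?thesis using that[of "\<lambda>x. 0"] by simp
next
  case False
  then obtain f where f: "f \<in> elts H" and "L f \<noteq> 0" by blast
  have diff: "L (\<lambda>x. f x - g x) = L f - L g" if "f \<in> elts H" "g \<in> elts H" for f g
    using add[of f "\<lambda>x. (-1) * g x"] scale[of g "-1"] that by simp
  define V where "V = {f \<in> elts H. L f = 0}"
  have V: "V \<subseteq> elts H" "(\<lambda>x. 0) \<in> V"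
    using scale[of "\<lambda>x. 0" 0] by (auto simp: V_def)
  obtain v p where v: "\<And>n. v n \<in> V" "converges_in H v p"
    and orth: "\<And>u. u \<in> V \<Longrightarrow> inn H (\<lambda>x. f x - p x) u = 0"
    using projection[OF V _ _ f] by (auto simp: V_def add scale)
  have pE: "p \<in> elts H" and lim: "(\<lambda>n. fnorm H (\<lambda>x. v n x - p x)) \<longlonglongrightarrow> 0"
    using v by (auto simp: converges_in_def)
  \<comment> \<open>Each \<open>v n\<close> lies in the kernel, so \<open>L\<close> sends
    \<open>v n - p\<close> to \<open>- L p\<close>, and the norms of \<open>v n - p\<close> tend to
    0.\<close>
  have "(\<lambda>n. - L p) \<longlonglongrightarrow> 0"
  proof (rule Lim_null_comparison)
    show "(\<lambda>n. C * fnorm H (\<lambda>x. v n x - p x)) \<longlonglongrightarrow> 0"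
      using tendsto_mult_left[OF lim, of C] by simp
    show "\<forall>\<^sub>F n in sequentially. norm (- L p) \<le> C * fnorm H (\<lambda>x. v n x - p x)"
      using bound[of "\<lambda>x. v _ x - p x"] diff[of "v _" p] v(1) pE
      by (intro always_eventually) (auto simp: V_def)
  qed
  then have Lp: "L p = 0" by (simp add: LIMSEQ_const_iff)
  define u where "u = (\<lambda>x. f x - p x)"
  have uE: "u \<in> elts H" and Lu: "L u \<noteq> 0"
    using f pE \<open>L f \<noteq> 0\<close> Lp diff[of f p] by (auto simp: u_def)
  have "inn H u u \<noteq> 0"
  proof
    assume "inn H u u = 0"
    then have "u = (\<lambda>x. 0)" using inn_eq_zero uE by blast
    then show False using Lu scale[of "\<lambda>x. 0" 0] by simp
  qed
  \<comment> \<open>The factor is chosen so that \<open>inn H u h = L u\<close>; any other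
    \<open>g\<close> differs from a multiple of \<open>u\<close> by an element of the
    kernel.\<close>
  define h where "h = (\<lambda>x. cnj (L u / inn H u u) * u x)"
  have "L g = inn H g h" if g: "g \<in> elts H" for g
  proof -
    define c where "c = L g / L u"
    have "c * L u = L g" using Lu by (simp add: c_def)
    then have "(\<lambda>x. g x - c * u x) \<in> V"
      using g uE diff[of g "\<lambda>x. c * u x"] scale[of u c] by (simp add: V_def)
    then have "inn H u (\<lambda>x. g x - c * u x) = 0" using orth by (simp add: u_def)
    then have "inn H (\<lambda>x. g x - c * u x) u = 0"
      using inn_commute[of u "\<lambda>x. g x - c * u x"] g uE by simp
    then have "inn H g u = c * inn H u u" using g uE by simp
    then show ?thesis
      using g uE Lu \<open>inn H u u \<noteq> 0\<close> unfolding h_def c_def by (subst inn_scale_right) auto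
  qed
  moreover have "h \<in> elts H" unfolding h_def using uE by (rule scale_mem)
  ultimately show ?thesis using that by blast
qed

end

section \<open>Defects of contractions and compact forms\<close>

definition bounded_op ::
    "'x fun_space \<Rightarrow> (('x \<Rightarrow> complex) \<Rightarrow> ('x \<Rightarrow> complex)) \<Rightarrow> bool" where
  "bounded_op H T \<longleftrightarrow> linear_between H H T \<and> (\<exists>C. \<forall>f\<in>elts H. fnorm H (T f) \<le> C * fnorm H f)"

text \<open>The quadratic form of \<open>I - T T\<^sup>*\<close>.\<close>

definition defect ::
    "'x fun_space \<Rightarrow> (('x \<Rightarrow> complex) \<Rightarrow> ('x \<Rightarrow> complex)) \<Rightarrow> ('x \<Rightarrow> complex) \<Rightarrow> real" where
  "defect H T f = (fnorm H f)\<^sup>2 - (fnorm H (adjoint_op H T f))\<^sup>2"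

text \<open>For the form \<open>q\<close> of a positive bounded operator this is compactness of its square root,
  hence of the operator itself.\<close>

definition compact_form :: "'x fun_space \<Rightarrow> (('x \<Rightarrow> complex) \<Rightarrow> real) \<Rightarrow> bool" where
  "compact_form H q \<longleftrightarrow>
     (\<forall>F C. (\<forall>n. F n \<in> elts H \<and> fnorm H (F n) \<le> C) \<longrightarrow>
       (\<exists>r::nat \<Rightarrow> nat. strict_mono r \<and>
         (\<forall>e>0. \<exists>N. \<forall>m\<ge>N. \<forall>n\<ge>N. q (\<lambda>x. F (r m) x - F (r n) x) < e)))"

section \<open>Stability of compact forms\<close>

lemma bounded_opI:
  "linear_between H H T \<Longrightarrow> (\<And>f. f \<in> elts H \<Longrightarrow> fnorm H (T f) \<le> C * fnorm H f) \<Longrightarrow> bounded_op H T"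
  unfolding bounded_op_def by blast

lemma bounded_op_mem: "bounded_op H T \<Longrightarrow> f \<in> elts H \<Longrightarrow> T f \<in> elts H"
  unfolding bounded_op_def linear_between_def by blast

lemma bounded_op_add:
  "bounded_op H T \<Longrightarrow> f \<in> elts H \<Longrightarrow> g \<in> elts H \<Longrightarrow> T (\<lambda>x. f x + g x) = (\<lambda>x. T f x + T g x)"
  unfolding bounded_op_def linear_between_def by blast

lemma bounded_op_scale:
  "bounded_op H T \<Longrightarrow> f \<in> elts H \<Longrightarrow> T (\<lambda>x. c * f x) = (\<lambda>x. c * T f x)"
  unfolding bounded_op_def linear_between_def by blast

text \<open>A subsequence that works for \<open>q\<close> also works for \<open>q'\<close>, with
  \<open>e / c\<close> as the tolerance for \<open>q\<close>.\<close>

lemma compact_form_le: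
  fixes H :: "'x fun_space"
  assumes q: "compact_form H q" and le: "\<And>f. f \<in> elts H \<Longrightarrow> q' f \<le> c * q f" and "c > 0"
    and diff: "\<And>f g. f \<in> elts H \<Longrightarrow> g \<in> elts H \<Longrightarrow> (\<lambda>x. f x - g x) \<in> elts H"
  shows "compact_form H q'"
  unfolding compact_form_def
proof (intro allI impI)
  fix F :: "nat \<Rightarrow> 'x \<Rightarrow> complex" and C assume F: "\<forall>n. F n \<in> elts H \<and> fnorm H (F n) \<le> C"
  then obtain r :: "nat \<Rightarrow> nat" where r: "strict_mono r"
    and small: "\<forall>e>0. \<exists>N. \<forall>m\<ge>N. \<forall>n\<ge>N. q (\<lambda>x. F (r m) x - F (r n) x) < e"
    using q[unfolded compact_form_def] by blast
  have "\<exists>N. \<forall>m\<ge>N. \<forall>n\<ge>N. q' (\<lambda>x. F (r m) x - F (r n) x) < e" if "e > 0" for e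
  proof -
    from that obtain N where N: "\<And>m n. m \<ge> N \<Longrightarrow> n \<ge> N \<Longrightarrow> q (\<lambda>x. F (r m) x - F (r n) x) < e / c"
      using small \<open>c > 0\<close> by (metis divide_pos_pos)
    have "q' (\<lambda>x. F (r m) x - F (r n) x) < e" if "m \<ge> N" "n \<ge> N" for m n
      using le[of "\<lambda>x. F (r m) x - F (r n) x"] diff[of "F (r m)" "F (r n)"] F N[OF that] \<open>c > 0\<close>
      by (fastforce simp: field_simps)
    then show ?thesis by blast
  qed
  then show "\<exists>r::nat \<Rightarrow> nat. strict_mono r \<and>
      (\<forall>e>0. \<exists>N. \<forall>m\<ge>N. \<forall>n\<ge>N. q' (\<lambda>x. F (r m) x - F (r n) x) < e)"
    using r by blast
qed

text \<open>\<open>R\<close> sends bounded sequences to bounded sequences and commutes with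
  differences, so the subsequence chosen for the images serves the original sequence.\<close>

lemma compact_form_comp:
  fixes H :: "'x fun_space"
  assumes q: "compact_form H q"
    and mem: "\<And>f. f \<in> elts H \<Longrightarrow> R f \<in> elts H"
    and bound: "\<And>f. f \<in> elts H \<Longrightarrow> fnorm H (R f) \<le> K * fnorm H f" and "K \<ge> 0"
    and diff: "\<And>f g. f \<in> elts H \<Longrightarrow> g \<in> elts H \<Longrightarrow> R (\<lambda>x. f x - g x) = (\<lambda>x. R f x - R g x)"
  shows "compact_form H (\<lambda>f. q (R f))"
  unfolding compact_form_def
proof (intro allI impI)
  fix F :: "nat \<Rightarrow> 'x \<Rightarrow> complex" and C assume F: "\<forall>n. F n \<in> elts H \<and> fnorm H (F n) \<le> C"
  have "fnorm H (R (F n)) \<le> K * C" for n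
    using bound[of "F n"] mult_left_mono[of "fnorm H (F n)" C K] F \<open>K \<ge> 0\<close> by fastforce
  then have "R (F n) \<in> elts H \<and> fnorm H (R (F n)) \<le> K * C" for n using mem F by blast
  from q[unfolded compact_form_def, rule_format, OF this]
  show "\<exists>r::nat \<Rightarrow> nat. strict_mono r \<and>
      (\<forall>e>0. \<exists>N. \<forall>m\<ge>N. \<forall>n\<ge>N. q (R (\<lambda>x. F (r m) x - F (r n) x)) < e)"
    using F by (simp add: diff)
qed

text \<open>Extract a subsequence for \<open>q\<close> first, and from it a further one for
  \<open>q'\<close>.\<close>

lemma compact_form_add:
  fixes H :: "'x fun_space"
  assumes q: "compact_form H q" and q': "compact_form H q'"
  shows "compact_form H (\<lambda>f. q f + q' f)"
  unfolding compact_form_def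
proof (intro allI impI)
  fix F :: "nat \<Rightarrow> 'x \<Rightarrow> complex" and C assume F: "\<forall>n. F n \<in> elts H \<and> fnorm H (F n) \<le> C"
  then obtain r :: "nat \<Rightarrow> nat" where r: "strict_mono r"
    and small: "\<forall>e>0. \<exists>N. \<forall>m\<ge>N. \<forall>n\<ge>N. q (\<lambda>x. F (r m) x - F (r n) x) < e"
    using q[unfolded compact_form_def] by blast
  have "\<forall>n. (F \<circ> r) n \<in> elts H \<and> fnorm H ((F \<circ> r) n) \<le> C" using F by simp
  then obtain s :: "nat \<Rightarrow> nat" where s: "strict_mono s"
    and small': "\<forall>e>0. \<exists>N. \<forall>m\<ge>N. \<forall>n\<ge>N. q' (\<lambda>x. (F \<circ> r) (s m) x - (F \<circ> r) (s n) x) < e"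
    using q'[unfolded compact_form_def] by blast
  have "\<exists>N. \<forall>m\<ge>N. \<forall>n\<ge>N. q (\<lambda>x. F ((r \<circ> s) m) x - F ((r \<circ> s) n) x)
      + q' (\<lambda>x. F ((r \<circ> s) m) x - F ((r \<circ> s) n) x) < e" if "e > 0" for e
  proof -
    from that have "e / 2 > 0" by simp
    obtain N where N: "\<And>m n. m \<ge> N \<Longrightarrow> n \<ge> N \<Longrightarrow> q (\<lambda>x. F (r m) x - F (r n) x) < e / 2"
      using small \<open>e / 2 > 0\<close> by meson
    obtain N' where N': "\<And>m n. m \<ge> N' \<Longrightarrow> n \<ge> N' \<Longrightarrow>
        q' (\<lambda>x. (F \<circ> r) (s m) x - (F \<circ> r) (s n) x) < e / 2"
      using small' \<open>e / 2 > 0\<close> by meson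
    have "q (\<lambda>x. F ((r \<circ> s) m) x - F ((r \<circ> s) n) x)
        + q' (\<lambda>x. F ((r \<circ> s) m) x - F ((r \<circ> s) n) x) < e"
      if "m \<ge> max N N'" "n \<ge> max N N'" for m n
      \<comment> \<open>As \<open>s m \<ge> m\<close>, the threshold found along \<open>r\<close>
        remains valid along \<open>r \<circ> s\<close>.\<close>
      using N[of "s m" "s n"] N'[of m n] that seq_suble[OF s, of m] seq_suble[OF s, of n] by simp
    then show ?thesis by blast
  qed
  then show "\<exists>r::nat \<Rightarrow> nat. strict_mono r \<and> (\<forall>e>0. \<exists>N. \<forall>m\<ge>N. \<forall>n\<ge>N.
      q (\<lambda>x. F (r m) x - F (r n) x) + q' (\<lambda>x. F (r m) x - F (r n) x) < e)"
    using strict_mono_o[OF r s] by blast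
qed

context hilbert_function_space
begin

section \<open>Adjoints of bounded operators\<close>

lemma ext_inn:
  assumes "h \<in> elts H" "h' \<in> elts H" "\<And>f. f \<in> elts H \<Longrightarrow> inn H f h = inn H f h'"
  shows "h = h'"
proof -
  have "(\<lambda>x. h x - h' x) = (\<lambda>x. 0)"
    using assms assms(3)[of "\<lambda>x. h x - h' x"] by (intro inn_eq_zero) auto
  then show ?thesis by (simp add: fun_eq_iff)
qed

text \<open>Uniqueness of the adjoint. Later adjoints are computed by naming a candidate
  \<open>h\<close> and checking the pairing.\<close>

lemma adjoint_op_eqI:
  assumes "h \<in> elts H" "\<And>f. f \<in> elts H \<Longrightarrow> inn H (T f) g = inn H f h"
  shows "adjoint_op H T g = h"
  unfolding adjoint_op_def
proof (rule the_equality)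
  fix h' assume "h' \<in> elts H \<and> (\<forall>f\<in>elts H. inn H (T f) g = inn H f h')"
  then show "h' = h" using assms by (intro ext_inn) auto
qed (use assms in blast)

text \<open>Existence: for fixed \<open>g\<close> the functional sending \<open>f\<close> to
  \<open>inn H (T f) g\<close> is bounded, and Riesz represents it.\<close>

lemma adjoint_op:
  assumes T: "bounded_op H T" and g: "g \<in> elts H"
  shows adjoint_op_mem: "adjoint_op H T g \<in> elts H"
    and inn_adjoint_op: "\<And>f. f \<in> elts H \<Longrightarrow> inn H f (adjoint_op H T g) = inn H (T f) g"
proof -
  obtain C where C: "\<And>f. f \<in> elts H \<Longrightarrow> fnorm H (T f) \<le> C * fnorm H f"
    using T unfolding bounded_op_def by blast
  have "cmod (inn H (T f) g) \<le> (C * fnorm H g) * fnorm H f" if f: "f \<in> elts H" for f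
    using Cauchy_Schwarz[OF bounded_op_mem[OF T f] g] mult_right_mono[OF C[OF f] fnorm_nonneg[OF g]]
    by (simp add: mult_ac)
  then obtain h where h: "h \<in> elts H" "\<And>f. f \<in> elts H \<Longrightarrow> inn H (T f) g = inn H f h"
    using Riesz[of "\<lambda>f. inn H (T f) g" "C * fnorm H g"] g
    by (auto simp: bounded_op_add[OF T] bounded_op_scale[OF T] bounded_op_mem[OF T])
  then have "adjoint_op H T g = h" by (rule adjoint_op_eqI)
  then show "adjoint_op H T g \<in> elts H"
    and "\<And>f. f \<in> elts H \<Longrightarrow> inn H f (adjoint_op H T g) = inn H (T f) g"
    using h by simp_all
qed

lemma inn_adjoint_op_left:
  assumes "bounded_op H T" "f \<in> elts H" "g \<in> elts H"
  shows "inn H (adjoint_op H T g) f = inn H g (T f)"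
  using inn_adjoint_op[OF assms(1,3,2)] inn_commute[of f "adjoint_op H T g"] inn_commute[of "T f" g]
    adjoint_op_mem[OF assms(1,3)] bounded_op_mem[OF assms(1,2)] assms by simp

lemma adjoint_op_add:
  assumes "bounded_op H T" "f \<in> elts H" "g \<in> elts H"
  shows "adjoint_op H T (\<lambda>x. f x + g x) = (\<lambda>x. adjoint_op H T f x + adjoint_op H T g x)"
  using assms by (intro adjoint_op_eqI) (auto simp: adjoint_op_mem bounded_op_mem inn_adjoint_op)

lemma adjoint_op_scale:
  assumes "bounded_op H T" "f \<in> elts H"
  shows "adjoint_op H T (\<lambda>x. c * f x) = (\<lambda>x. c * adjoint_op H T f x)"
  using assms by (intro adjoint_op_eqI) (auto simp: adjoint_op_mem bounded_op_mem inn_adjoint_op)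

lemma adjoint_op_diff:
  assumes "bounded_op H T" "f \<in> elts H" "g \<in> elts H"
  shows "adjoint_op H T (\<lambda>x. f x - g x) = (\<lambda>x. adjoint_op H T f x - adjoint_op H T g x)"
  using assms by (intro adjoint_op_eqI) (auto simp: adjoint_op_mem bounded_op_mem inn_adjoint_op)

lemma adjoint_op_comp:
  assumes "bounded_op H T" "bounded_op H U" "f \<in> elts H"
  shows "adjoint_op H (\<lambda>g. T (U g)) f = adjoint_op H U (adjoint_op H T f)"
  using assms by (intro adjoint_op_eqI) (auto simp: adjoint_op_mem bounded_op_mem inn_adjoint_op)

text \<open>With \<open>h = adjoint_op H T g\<close>, the square of the norm of \<open>h\<close>
  equals \<open>inn H (T h) g\<close>, which is at most \<open>C\<close> times the norms of
  \<open>h\<close> and \<open>g\<close>; cancel one norm of \<open>h\<close>.\<close>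

lemma fnorm_adjoint_op_le:
  assumes T: "bounded_op H T" and C: "\<And>f. f \<in> elts H \<Longrightarrow> fnorm H (T f) \<le> C * fnorm H f"
    and "C \<ge> 0" and g: "g \<in> elts H"
  shows "fnorm H (adjoint_op H T g) \<le> C * fnorm H g"
proof (cases "fnorm H (adjoint_op H T g) = 0")
  case True
  then show ?thesis using \<open>C \<ge> 0\<close> g by simp
next
  case False
  let ?h = "adjoint_op H T g"
  have h: "?h \<in> elts H" using T g by (rule adjoint_op_mem)
  have "(fnorm H ?h)\<^sup>2 = Re (inn H (T ?h) g)"
    using inn_adjoint_op[OF T g h] by (simp add: fnorm_power2[OF h])
  also have "\<dots> \<le> fnorm H (T ?h) * fnorm H g"
    using Cauchy_Schwarz[OF bounded_op_mem[OF T h] g] complex_Re_le_cmod order_trans by blast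
  also have "\<dots> \<le> (C * fnorm H ?h) * fnorm H g"
    using C[OF h] g by (intro mult_right_mono) auto
  finally have "fnorm H ?h * fnorm H ?h \<le> fnorm H ?h * (C * fnorm H g)"
    by (simp add: power2_eq_square mult_ac)
  then show ?thesis using False fnorm_nonneg[OF h] by (simp add: mult_le_cancel_left)
qed

lemma contractive_adjoint_op:
  assumes "bounded_op H T" "contractive_on H T" "g \<in> elts H"
  shows "fnorm H (adjoint_op H T g) \<le> fnorm H g"
  using fnorm_adjoint_op_le[of T 1 g] assms by (simp add: contractive_on_def)

section \<open>Defect forms and compactness of the defect operator\<close>

lemma defect_nonneg:
  assumes "bounded_op H T" "contractive_on H T" "f \<in> elts H"
  shows "0 \<le> defect H T f"
  using contractive_adjoint_op[OF assms] adjoint_op_mem[OF assms(1,3)]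
  by (simp add: defect_def power_mono)

text \<open>The adjoint of a product reverses the order, and the norm of
  \<open>adjoint_op H T f\<close> cancels between the two summands.\<close>

lemma defect_comp:
  assumes "bounded_op H T" "bounded_op H U" "f \<in> elts H"
  shows "defect H (\<lambda>g. T (U g)) f = defect H T f + defect H U (adjoint_op H T f)"
  using adjoint_op_comp[OF assms] by (simp add: defect_def)

lemma defect_eq_inn:
  assumes "bounded_op H T" "f \<in> elts H"
  shows "defect H T f = Re (inn H (\<lambda>x. f x - T (adjoint_op H T f) x) f)"
  using assms inn_adjoint_op[of T f "adjoint_op H T f"]
  by (simp add: defect_def fnorm_power2 adjoint_op_mem bounded_op_mem)

text \<open>Since \<open>I - T T\<^sup>*\<close> is a positive contraction, its square is dominated by itself.\<close>

lemma fnorm_defect_operator_power2_le: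
  assumes T: "bounded_op H T" "contractive_on H T" and f: "f \<in> elts H"
  shows "(fnorm H (\<lambda>x. f x - T (adjoint_op H T f) x))\<^sup>2 \<le> defect H T f"
proof -
  let ?h = "adjoint_op H T f"
  have h: "?h \<in> elts H" and Th: "T ?h \<in> elts H"
    using adjoint_op_mem[OF T(1) f] bounded_op_mem[OF T(1)] by blast+
  have "Re (inn H f (T ?h)) = (fnorm H ?h)\<^sup>2"
    using inn_adjoint_op_left[OF T(1) h f] h by (simp add: fnorm_power2)
  moreover have "(fnorm H (T ?h))\<^sup>2 \<le> (fnorm H ?h)\<^sup>2"
    using T(2) h Th by (intro power_mono) (auto simp: contractive_on_def)
  ultimately show ?thesis
    by (simp add: fnorm_diff_power2[OF f Th] defect_def)
qed

text \<open>The form is the pairing of \<open>D f\<close> with \<open>f\<close>, so on differences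
  of a bounded sequence it is controlled by the norm of \<open>D f\<close>. The hypothesis asks only
  for convergent subsequences of images, so that compactness of the inclusion can supply it as
  well.\<close>

lemma compact_form_defect_if_bound:
  assumes T: "bounded_op H T" "contractive_on H T"
    and D: "\<And>F C. (\<forall>n::nat. F n \<in> elts H \<and> fnorm H (F n) \<le> C) \<Longrightarrow>
      \<exists>(r::nat \<Rightarrow> nat) g. strict_mono r \<and>
        converges_in H (\<lambda>n x. F (r n) x - T (adjoint_op H T (F (r n))) x) g"
  shows "compact_form H (defect H T)"
  unfolding compact_form_def
proof (intro allI impI)
  define D where "D f = (\<lambda>x. f x - T (adjoint_op H T f) x)" for f
  have D_mem: "D f \<in> elts H" if "f \<in> elts H" for f
    using that T by (simp add: D_def adjoint_op_mem bounded_op_mem)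
  have T_diff: "T (\<lambda>x. f x - g x) = (\<lambda>x. T f x - T g x)" if "f \<in> elts H" "g \<in> elts H" for f g
    using bounded_op_add[OF T(1), of f "\<lambda>x. (-1) * g x"] bounded_op_scale[OF T(1), of g "-1"] that
    by simp
  have D_diff: "D (\<lambda>x. f x - g x) = (\<lambda>x. D f x - D g x)" if "f \<in> elts H" "g \<in> elts H" for f g
    unfolding D_def using T that
    by (simp add: adjoint_op_diff adjoint_op_mem T_diff fun_eq_iff algebra_simps)
  fix F :: "nat \<Rightarrow> 'x \<Rightarrow> complex" and C
  assume F: "\<forall>n. F n \<in> elts H \<and> fnorm H (F n) \<le> C"
  then obtain r :: "nat \<Rightarrow> nat" and g where r: "strict_mono r"
    and conv: "converges_in H (\<lambda>n. D (F (r n))) g"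
    using D[of F C] unfolding D_def by blast
  have "\<exists>N. \<forall>m\<ge>N. \<forall>n\<ge>N. defect H T (\<lambda>x. F (r m) x - F (r n) x) < e" if "e > 0" for e
  proof -
    have "C \<ge> 0" using F fnorm_nonneg order_trans by blast
    \<comment> \<open>The differences have norm at most \<open>2 * C\<close>; adding 1 keeps the
      denominator positive when \<open>C = 0\<close>.\<close>
    have "e / (2 * C + 1) > 0" using \<open>C \<ge> 0\<close> \<open>e > 0\<close> by simp
    from converges_in_Cauchy[OF _ conv this] D_mem F
    obtain N where N: "\<And>m n. m \<ge> N \<Longrightarrow> n \<ge> N \<Longrightarrow>
        fnorm H (\<lambda>x. D (F (r m)) x - D (F (r n)) x) < e / (2 * C + 1)"
      by blast
    have "defect H T (\<lambda>x. F (r m) x - F (r n) x) < e" if mn: "m \<ge> N" "n \<ge> N" for m n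
    proof -
      let ?f = "\<lambda>x. F (r m) x - F (r n) x"
      have f: "?f \<in> elts H" using F by simp
      have "fnorm H ?f \<le> 2 * C"
        using fnorm_triangle_diff[of "F (r m)" "F (r n)"] F by (smt (verit))
      have "defect H T ?f = Re (inn H (D ?f) ?f)"
        using defect_eq_inn[OF T(1) f] by (simp add: D_def)
      also have "\<dots> \<le> fnorm H (D ?f) * fnorm H ?f"
        using Cauchy_Schwarz[OF D_mem[OF f] f] complex_Re_le_cmod order_trans by blast
      also have "\<dots> \<le> fnorm H (D ?f) * (2 * C + 1)"
        using \<open>fnorm H ?f \<le> 2 * C\<close> D_mem[OF f] by (intro mult_left_mono) auto
      also have "D ?f = (\<lambda>x. D (F (r m)) x - D (F (r n)) x)"
        using F by (intro D_diff) auto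
      also have "fnorm H (\<lambda>x. D (F (r m)) x - D (F (r n)) x) * (2 * C + 1) < e"
        using N[OF mn] \<open>C \<ge> 0\<close> by (simp add: pos_less_divide_eq)
      finally show ?thesis .
    qed
    then show ?thesis by blast
  qed
  then show "\<exists>r::nat \<Rightarrow> nat. strict_mono r \<and>
      (\<forall>e>0. \<exists>N. \<forall>m\<ge>N. \<forall>n\<ge>N. defect H T (\<lambda>x. F (r m) x - F (r n) x) < e)"
    using r by blast
qed

text \<open>For the converse, the squared norm of the defect operator at \<open>f\<close> is at most
  the form at \<open>f\<close>. Smallness of the form on differences thus gives a Cauchy sequence of
  images, and completeness gives its limit.\<close>

lemma compact_operator_defect_iff:
  assumes T: "bounded_op H T" "contractive_on H T"
  shows "compact_operator H H (\<lambda>f x. f x - T (adjoint_op H T f) x) \<longleftrightarrow> compact_form H (defect H T)"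
proof
  assume "compact_operator H H (\<lambda>f x. f x - T (adjoint_op H T f) x)"
  then show "compact_form H (defect H T)"
    unfolding compact_operator_def by (intro compact_form_defect_if_bound[OF T]) blast
next
  assume q: "compact_form H (defect H T)"
  define D where "D f = (\<lambda>x. f x - T (adjoint_op H T f) x)" for f
  have lin: "linear_between H H D"
    using T unfolding linear_between_def D_def
    by (auto simp: adjoint_op_mem bounded_op_mem adjoint_op_add adjoint_op_scale bounded_op_add
        bounded_op_scale algebra_simps)
  then have D_mem: "D f \<in> elts H" if "f \<in> elts H" for f
    using that by (simp add: linear_between_def)
  have D_diff: "D (\<lambda>x. f x - g x) = (\<lambda>x. D f x - D g x)" if "f \<in> elts H" "g \<in> elts H" for f g
  proof -
    have "D (\<lambda>x. f x + (-1) * g x) = (\<lambda>x. D f x + D (\<lambda>x. (-1) * g x) x)"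
      using lin that unfolding linear_between_def by (metis scale_mem)
    also have "D (\<lambda>x. (-1) * g x) = (\<lambda>x. (-1) * D g x)"
      using lin that unfolding linear_between_def by blast
    finally show ?thesis by simp
  qed
  have "\<exists>(r::nat \<Rightarrow> nat) g. strict_mono r \<and> converges_in H (\<lambda>n. D (F (r n))) g"
    if F: "\<forall>n. F n \<in> elts H \<and> fnorm H (F n) \<le> C" for F C
  proof -
    from F obtain r :: "nat \<Rightarrow> nat" where r: "strict_mono r"
      and small: "\<forall>e>0. \<exists>N. \<forall>m\<ge>N. \<forall>n\<ge>N. defect H T (\<lambda>x. F (r m) x - F (r n) x) < e"
      using q[unfolded compact_form_def] by blast
    have "\<exists>g. converges_in H (\<lambda>n. D (F (r n))) g"
    proof (rule complete)
      show "D (F (r n)) \<in> elts H" for n using F D_mem by blast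
      fix e :: real assume "e > 0"
      then have "e\<^sup>2 > 0" by simp
      then obtain N where N: "\<And>m n. m \<ge> N \<Longrightarrow> n \<ge> N \<Longrightarrow> defect H T (\<lambda>x. F (r m) x - F (r n) x) < e\<^sup>2"
        using small by meson
      have "fnorm H (\<lambda>x. D (F (r m)) x - D (F (r n)) x) < e" if mn: "m \<ge> N" "n \<ge> N" for m n
      proof (rule power2_less_imp_less)
        have "(fnorm H (D (\<lambda>x. F (r m) x - F (r n) x)))\<^sup>2 \<le> defect H T (\<lambda>x. F (r m) x - F (r n) x)"
          unfolding D_def using T F by (intro fnorm_defect_operator_power2_le) auto
        then show "(fnorm H (\<lambda>x. D (F (r m)) x - D (F (r n)) x))\<^sup>2 < e\<^sup>2"
          using D_diff[of "F (r m)" "F (r n)"] F N[OF mn] by auto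
      qed (use \<open>e > 0\<close> in simp)
      then show "\<exists>N. \<forall>m\<ge>N. \<forall>n\<ge>N. fnorm H (\<lambda>x. D (F (r m)) x - D (F (r n)) x) < e" by blast
    qed
    then show ?thesis using r by blast
  qed
  then have "compact_operator H H D" using lin by (auto simp: compact_operator_def)
  then show "compact_operator H H (\<lambda>f x. f x - T (adjoint_op H T f) x)"
    by (simp add: D_def[abs_def])
qed

end

section \<open>The inclusion of the subspace\<close>

context rkhs
begin

section \<open>Kernel functions and multiplication operators\<close>

definition kernel_fun :: "'x \<Rightarrow> 'x \<Rightarrow> complex" where
  "kernel_fun w = (\<lambda>z. if z \<in> S then k z w else 0)"

lemma kernel_fun_mem [simp]: "w \<in> S \<Longrightarrow> kernel_fun w \<in> elts H"
  unfolding kernel_fun_def by (rule kernel_mem)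

lemma inn_kernel_fun: "w \<in> S \<Longrightarrow> f \<in> elts H \<Longrightarrow> inn H f (kernel_fun w) = f w"
  unfolding kernel_fun_def by (rule reproducing[symmetric])

lemma fnorm_kernel_fun_power2: "w \<in> S \<Longrightarrow> (fnorm H (kernel_fun w))\<^sup>2 = Re (k w w)"
  using inn_kernel_fun[of w "kernel_fun w"] by (simp add: fnorm_power2) (simp add: kernel_fun_def)

text \<open>Pairing with a kernel function turns norm convergence into convergence of values. This
  makes limits taken in different spaces on \<open>S\<close> comparable.\<close>

lemma converges_in_pointwise:
  assumes "\<And>n. F n \<in> elts H" "converges_in H F f"
  shows "(\<lambda>n. F n x) \<longlonglongrightarrow> f x"
proof (cases "x \<in> S")
  case True
  have "f \<in> elts H" using assms by (simp add: converges_in_def)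
  then show ?thesis
    using inn_tendsto[OF assms, of "kernel_fun x"] True assms by (simp add: inn_kernel_fun)
next
  case False
  have "f \<in> elts H" using assms by (simp add: converges_in_def)
  then show ?thesis using supported[of f x] supported[OF assms(1) False] False by simp
qed

lemma Mult_mem: "\<phi> \<in> Mult H \<Longrightarrow> f \<in> elts H \<Longrightarrow> mult_op \<phi> f \<in> elts H"
  by (simp add: Mult_def)

lemma bounded_op_mult_op:
  assumes "\<phi> \<in> Mult H" "\<And>f. f \<in> elts H \<Longrightarrow> fnorm H (mult_op \<phi> f) \<le> C * fnorm H f"
  shows "bounded_op H (mult_op \<phi>)"
proof (rule bounded_opI[OF _ assms(2)])
  show "linear_between H H (mult_op \<phi>)"
    using assms(1) by (auto simp: linear_between_def Mult_def mult_op_def algebra_simps)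
qed

lemma bounded_op_mult_op_contractive:
  "\<phi> \<in> Mult H \<Longrightarrow> contractive_on H (mult_op \<phi>) \<Longrightarrow> bounded_op H (mult_op \<phi>)"
  using bounded_op_mult_op[of \<phi> 1] by (simp add: contractive_on_def)

text \<open>Both pairings with \<open>f\<close> evaluate to \<open>\<phi> w * f w\<close>, so kernel
  functions are eigenvectors of adjoints of multiplication operators.\<close>

lemma adjoint_mult_op_kernel_fun:
  assumes "\<phi> \<in> Mult H" "w \<in> S"
  shows "adjoint_op H (mult_op \<phi>) (kernel_fun w) = (\<lambda>x. cnj (\<phi> w) * kernel_fun w x)"
  using assms Mult_mem[OF assms(1)]
  by (intro adjoint_op_eqI) (auto simp: inn_kernel_fun mult_op_def)

text \<open>The linear span, in inductive form so that linear identities reduce by rule induction to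
  kernel functions.\<close>

inductive_set kernel_span :: "('x \<Rightarrow> complex) set" where
  zero: "(\<lambda>x. 0) \<in> kernel_span"
| kernel: "w \<in> S \<Longrightarrow> kernel_fun w \<in> kernel_span"
| add: "f \<in> kernel_span \<Longrightarrow> g \<in> kernel_span \<Longrightarrow> (\<lambda>x. f x + g x) \<in> kernel_span"
| scale: "f \<in> kernel_span \<Longrightarrow> (\<lambda>x. c * f x) \<in> kernel_span"

lemma kernel_span_subset: "f \<in> kernel_span \<Longrightarrow> f \<in> elts H"
  by (induction rule: kernel_span.induct) auto

lemma kernel_span_diff:
  "f \<in> kernel_span \<Longrightarrow> g \<in> kernel_span \<Longrightarrow> (\<lambda>x. f x - g x) \<in> kernel_span"
  using kernel_span.add[OF _ kernel_span.scale[of g "-1"], of f] by simp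

text \<open>A function orthogonal to every kernel function vanishes at every point of
  \<open>S\<close>.\<close>

lemma kernel_span_dense:
  assumes "f \<in> elts H"
  obtains v where "\<And>n. v n \<in> kernel_span" "converges_in H v f"
proof (rule dense_if_orthogonal_trivial[OF _ _ _ _ _ assms])
  fix h assume h: "h \<in> elts H" and orth: "\<And>u. u \<in> kernel_span \<Longrightarrow> inn H h u = 0"
  show "h = (\<lambda>x. 0)"
  proof
    fix x show "h x = 0"
      using orth[OF kernel_span.kernel, of x] inn_kernel_fun[OF _ h, of x] supported[OF h, of x]
      by (cases "x \<in> S") auto
  qed
qed (use kernel_span_subset that kernel_span.intros in blast)+

end

text \<open>\<open>Hb\<close> is specified through its kernel alone; its contractive containment in
  \<open>H\<close> is derived below.\<close>

locale sub_rkhs = rkhs S H k +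
  Hb: rkhs S Hb "\<lambda>z w. k z w * (1 - b z * cnj (b w))"
  for S :: "'x set" and H k Hb b +
  assumes b: "b \<in> Mult H" and contr: "contractive_on H (mult_op b)"
begin

text \<open>This is I - M_b M_b^*, first as an operator on \<open>H\<close>; its values turn out to
  lie in \<open>Hb\<close>.\<close>

definition A :: "('x \<Rightarrow> complex) \<Rightarrow> 'x \<Rightarrow> complex" where
  "A f = (\<lambda>x. f x - mult_op b (adjoint_op H (mult_op b) f) x)"

lemma bounded_op_b: "bounded_op H (mult_op b)"
  using b contr by (rule bounded_op_mult_op_contractive)

lemma adj_mem [simp]: "f \<in> elts H \<Longrightarrow> adjoint_op H (mult_op b) f \<in> elts H"
  using bounded_op_b by (rule adjoint_op_mem)

lemma A_mem [simp]: "f \<in> elts H \<Longrightarrow> A f \<in> elts H"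
  unfolding A_def using bounded_op_mem[OF bounded_op_b] by simp

lemma A_add: "f \<in> elts H \<Longrightarrow> g \<in> elts H \<Longrightarrow> A (\<lambda>x. f x + g x) = (\<lambda>x. A f x + A g x)"
  by (simp add: A_def adjoint_op_add[OF bounded_op_b] mult_op_def algebra_simps)

lemma A_scale: "f \<in> elts H \<Longrightarrow> A (\<lambda>x. c * f x) = (\<lambda>x. c * A f x)"
  by (simp add: A_def adjoint_op_scale[OF bounded_op_b] mult_op_def algebra_simps)

lemma A_diff: "f \<in> elts H \<Longrightarrow> g \<in> elts H \<Longrightarrow> A (\<lambda>x. f x - g x) = (\<lambda>x. A f x - A g x)"
  by (simp add: A_def adjoint_op_diff[OF bounded_op_b] mult_op_def algebra_simps)

lemma defect_eq_inn_A: "f \<in> elts H \<Longrightarrow> defect H (mult_op b) f = Re (inn H (A f) f)"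
  unfolding A_def by (rule defect_eq_inn[OF bounded_op_b])

lemma defect_le: "f \<in> elts H \<Longrightarrow> defect H (mult_op b) f \<le> (fnorm H f)\<^sup>2"
  by (simp add: defect_def)

lemma fnorm_A_le: "f \<in> elts H \<Longrightarrow> fnorm H (A f) \<le> fnorm H f"
  using order_trans[OF fnorm_defect_operator_power2_le[OF bounded_op_b contr] defect_le, of f]
  unfolding A_def[symmetric] by (rule power2_le_imp_le) auto

lemma A_kernel_fun:
  assumes "w \<in> S"
  shows "A (kernel_fun w) = Hb.kernel_fun w"
  using adjoint_mult_op_kernel_fun[OF b assms]
  unfolding A_def mult_op_def Hb.kernel_fun_def
  by (auto simp: kernel_fun_def fun_eq_iff right_diff_distrib mult_ac)

lemma A_kernel_span: "f \<in> kernel_span \<Longrightarrow> A f \<in> elts Hb"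
proof (induction rule: kernel_span.induct)
  case zero
  then show ?case using A_scale[OF zero_mem, of 0] Hb.zero_mem by simp
next
  case (kernel w)
  then show ?case by (simp add: A_kernel_fun)
qed (simp_all add: A_add A_scale kernel_span_subset Hb.add_mem Hb.scale_mem)

text \<open>By linearity it suffices to take \<open>g\<close> a kernel function. Then
  \<open>A g\<close> is the kernel function of \<open>Hb\<close>, and both sides are the value of
  \<open>A f\<close> at the same point.\<close>

lemma inn_A_kernel_span:
  assumes "f \<in> elts H" "A f \<in> elts Hb" "g \<in> kernel_span"
  shows "inn Hb (A f) (A g) = inn H (A f) g"
  using assms(3)
proof (induction rule: kernel_span.induct)
  case zero
  then show ?case using A_scale[OF zero_mem, of 0] assms by simp
next
  case (kernel w)
  then show ?case using assms by (simp add: A_kernel_fun inn_kernel_fun Hb.inn_kernel_fun)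
qed (simp_all add: A_add A_scale kernel_span_subset A_kernel_span assms)

text \<open>On the span, the squared \<open>Hb\<close>-norm of \<open>A u\<close> is the defect of
  \<open>u\<close>, hence at most the squared norm of \<open>u\<close>. So \<open>A (v n)\<close> is
  Cauchy in \<open>Hb\<close>, and comparing values identifies its limit there with its limit
  \<open>A f\<close> in \<open>H\<close>.\<close>

lemma A_mem_Hb_and_approx:
  assumes f: "f \<in> elts H" and v: "\<And>n. v n \<in> kernel_span" "converges_in H v f"
  shows "A f \<in> elts Hb" "converges_in Hb (\<lambda>n. A (v n)) (A f)"
proof -
  have vE: "v n \<in> elts H" and AvE: "A (v n) \<in> elts Hb" for n
    using v kernel_span_subset A_kernel_span by auto
  have diff: "fnorm Hb (\<lambda>x. A (v m) x - A (v n) x) \<le> fnorm H (\<lambda>x. v m x - v n x)" for m n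
  proof (rule power2_le_imp_le)
    let ?u = "\<lambda>x. v m x - v n x"
    have u: "?u \<in> kernel_span" "?u \<in> elts H" using v vE by (auto intro: kernel_span_diff)
    have "(fnorm Hb (A ?u))\<^sup>2 = defect H (mult_op b) ?u"
      using u A_kernel_span[OF u(1)] by (simp only: Hb.fnorm_power2 inn_A_kernel_span defect_eq_inn_A)
    also have "\<dots> \<le> (fnorm H ?u)\<^sup>2" using u by (intro defect_le)
    finally show "(fnorm Hb (\<lambda>x. A (v m) x - A (v n) x))\<^sup>2 \<le> (fnorm H ?u)\<^sup>2"
      using A_diff[OF vE vE] by simp
  qed (use vE in simp)
  have "\<exists>h. converges_in Hb (\<lambda>n. A (v n)) h"
  proof (rule Hb.complete[OF AvE])
    fix e :: real assume "e > 0"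
    from converges_in_Cauchy[OF vE v(2) this]
    show "\<exists>N. \<forall>m\<ge>N. \<forall>n\<ge>N. fnorm Hb (\<lambda>x. A (v m) x - A (v n) x) < e"
      using diff order_le_less_trans by meson
  qed
  then obtain h where h: "converges_in Hb (\<lambda>n. A (v n)) h" by blast
  have "converges_in H (\<lambda>n. A (v n)) (A f)"
    unfolding converges_in_def
  proof (intro conjI)
    have lim: "(\<lambda>n. fnorm H (\<lambda>x. v n x - f x)) \<longlonglongrightarrow> 0" using v by (simp add: converges_in_def)
    have "fnorm H (\<lambda>x. A (v n) x - A f x) \<le> fnorm H (\<lambda>x. v n x - f x)" for n
      using fnorm_A_le[of "\<lambda>x. v n x - f x"] A_diff[OF vE f, of n] vE f by simp
    then show "(\<lambda>n. fnorm H (\<lambda>x. A (v n) x - A f x)) \<longlonglongrightarrow> 0"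
      using vE f by (intro tendsto_sandwich[OF _ _ tendsto_const lim]) auto
  qed (use f in simp)
  then have "h = A f"
    using converges_in_pointwise[of "\<lambda>n. A (v n)" "A f"] Hb.converges_in_pointwise[OF AvE h] vE
    by (auto simp: fun_eq_iff intro: LIMSEQ_unique)
  then show "converges_in Hb (\<lambda>n. A (v n)) (A f)" using h by simp
  then show "A f \<in> elts Hb" by (simp add: converges_in_def)
qed

lemma A_mem_Hb [simp]: "f \<in> elts H \<Longrightarrow> A f \<in> elts Hb"
  using A_mem_Hb_and_approx(1) kernel_span_dense by metis

text \<open>Pass to the limit along span elements \<open>v n\<close> tending to \<open>f\<close>,
  where pairing \<open>A (v n)\<close> with \<open>A f\<close> in \<open>Hb\<close> equals pairing
  \<open>v n\<close> with \<open>A f\<close> in \<open>H\<close>.\<close>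

lemma fnorm_Hb_A_power2:
  assumes f: "f \<in> elts H"
  shows "(fnorm Hb (A f))\<^sup>2 = defect H (mult_op b) f"
proof -
  obtain v where v: "\<And>n. v n \<in> kernel_span" "converges_in H v f"
    using kernel_span_dense[OF f] by blast
  then have vE: "v n \<in> elts H" for n using kernel_span_subset by auto
  have "(\<lambda>n. inn Hb (A (v n)) (A f)) \<longlonglongrightarrow> inn Hb (A f) (A f)"
    using A_mem_Hb_and_approx[OF f v] vE f by (intro Hb.inn_tendsto) auto
  moreover have "(\<lambda>n. inn H (v n) (A f)) \<longlonglongrightarrow> inn H f (A f)"
    using v vE f by (intro inn_tendsto) auto
  moreover have "inn Hb (A (v n)) (A f) = inn H (v n) (A f)" for n
  proof -
    have "inn Hb (A f) (A (v n)) = inn H (A f) (v n)"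
      using f v by (intro inn_A_kernel_span) auto
    then show ?thesis
      using inn_commute[of "A f" "v n"] Hb.inn_commute[of "A f" "A (v n)"] f vE by simp
  qed
  ultimately have "inn Hb (A f) (A f) = inn H f (A f)" by (simp add: LIMSEQ_unique)
  then show ?thesis
    using f inn_commute[of "A f" f] by (simp add: Hb.fnorm_power2 defect_eq_inn_A)
qed

text \<open>The adjoint of \<open>A\<close>, as a map from \<open>H\<close> to \<open>Hb\<close>, is the inclusion.\<close>

lemma Hb_subset_and_inn:
  assumes g: "g \<in> elts Hb"
  shows Hb_subset: "g \<in> elts H"
    and inn_Hb_A: "\<And>f. f \<in> elts H \<Longrightarrow> inn Hb (A f) g = inn H f g"
proof -
  have "cmod (inn Hb (A f) g) \<le> fnorm Hb g * fnorm H f" if f: "f \<in> elts H" for f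
  proof -
    have "(fnorm Hb (A f))\<^sup>2 \<le> (fnorm H f)\<^sup>2"
      using fnorm_Hb_A_power2 defect_le f by simp
    then have "fnorm Hb (A f) \<le> fnorm H f" by (rule power2_le_imp_le) (use f in simp)
    then have "fnorm Hb (A f) * fnorm Hb g \<le> fnorm H f * fnorm Hb g"
      using g by (intro mult_right_mono) auto
    then show ?thesis using Hb.Cauchy_Schwarz[OF A_mem_Hb[OF f] g] by (simp add: mult.commute)
  qed
  \<comment> \<open>Riesz gives an element \<open>h\<close> of \<open>H\<close> representing the
    functional; testing it on kernel functions shows that \<open>h\<close> has the same values as
    \<open>g\<close>.\<close>
  then obtain h where h: "h \<in> elts H" and eq: "\<And>f. f \<in> elts H \<Longrightarrow> inn Hb (A f) g = inn H f h"
    using Riesz[of "\<lambda>f. inn Hb (A f) g" "fnorm Hb g"] g by (auto simp: A_add A_scale)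
  have "h x = g x" for x
  proof (cases "x \<in> S")
    case True
    have "inn H (kernel_fun x) h = inn Hb (Hb.kernel_fun x) g"
      using eq[of "kernel_fun x"] True by (simp add: A_kernel_fun)
    then have "inn H h (kernel_fun x) = inn Hb g (Hb.kernel_fun x)"
      using inn_commute[of "kernel_fun x" h] Hb.inn_commute[of "Hb.kernel_fun x" g] True h g by simp
    then show ?thesis using True h g by (simp add: inn_kernel_fun Hb.inn_kernel_fun)
  next
    case False
    then show ?thesis using supported[OF h] Hb.supported[OF g] by simp
  qed
  then have "h = g" by blast
  then show "g \<in> elts H" and "\<And>f. f \<in> elts H \<Longrightarrow> inn Hb (A f) g = inn H f g"
    using h eq by auto
qed

text \<open>Cauchy-Schwarz in \<open>Hb\<close> for \<open>A g\<close> and \<open>g\<close>. It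
  converts smallness of the form into smallness of the norm on bounded sets of
  \<open>Hb\<close>.\<close>

lemma fnorm_power2_le_defect:
  assumes g: "g \<in> elts Hb"
  shows "(fnorm H g)\<^sup>2 \<le> sqrt (defect H (mult_op b) g) * fnorm Hb g"
proof -
  have gE: "g \<in> elts H" using g by (rule Hb_subset)
  have "(fnorm H g)\<^sup>2 = Re (inn Hb (A g) g)" using inn_Hb_A[OF g gE] gE by (simp add: fnorm_power2)
  also have "\<dots> \<le> fnorm Hb (A g) * fnorm Hb g"
    using Hb.Cauchy_Schwarz[OF A_mem_Hb[OF gE] g] complex_Re_le_cmod order_trans by blast
  also have "fnorm Hb (A g) = sqrt (defect H (mult_op b) g)"
    using fnorm_Hb_A_power2[OF gE] gE by (metis A_mem_Hb Hb.fnorm_nonneg real_sqrt_unique)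
  finally show ?thesis .
qed

lemma fnorm_le_Hb:
  assumes g: "g \<in> elts Hb"
  shows "fnorm H g \<le> fnorm Hb g"
proof (cases "fnorm H g = 0")
  case True
  then show ?thesis using g by simp
next
  case False
  have gE: "g \<in> elts H" using g by (rule Hb_subset)
  have "sqrt (defect H (mult_op b) g) \<le> fnorm H g"
    using defect_le[OF gE] gE by (intro real_le_lsqrt) auto
  then have "(fnorm H g)\<^sup>2 \<le> fnorm H g * fnorm Hb g"
    using fnorm_power2_le_defect[OF g] g by (meson Hb.fnorm_nonneg mult_right_mono order_trans)
  then show ?thesis using False fnorm_nonneg[OF gE] by (simp add: power2_eq_square)
qed

text \<open>If the inclusion is compact, so is its composition with the contraction \<open>A\<close>
  from \<open>H\<close> to \<open>Hb\<close>, which is the defect operator. Conversely, a bounded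
  sequence of \<open>Hb\<close> is bounded in \<open>H\<close>, and
  \<open>fnorm_power2_le_defect\<close> makes a subsequence Cauchy.\<close>

lemma compact_inclusion_iff:
  "compact_operator Hb H (\<lambda>f. f) \<longleftrightarrow> compact_form H (defect H (mult_op b))"
proof
  assume J: "compact_operator Hb H (\<lambda>f. f)"
  show "compact_form H (defect H (mult_op b))"
  proof (rule compact_form_defect_if_bound[OF bounded_op_b contr])
    fix F :: "nat \<Rightarrow> 'x \<Rightarrow> complex" and C assume F: "\<forall>n. F n \<in> elts H \<and> fnorm H (F n) \<le> C"
    have "A (F n) \<in> elts Hb \<and> fnorm Hb (A (F n)) \<le> C" for n
    proof -
      have "(fnorm Hb (A (F n)))\<^sup>2 \<le> (fnorm H (F n))\<^sup>2"
        using fnorm_Hb_A_power2[of "F n"] defect_le[of "F n"] F by simp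
      then have "fnorm Hb (A (F n)) \<le> fnorm H (F n)" by (rule power2_le_imp_le) (use F in simp)
      then show ?thesis using F order_trans by auto
    qed
    then show "\<exists>(r::nat \<Rightarrow> nat) g. strict_mono r \<and>
        converges_in H (\<lambda>n x. F (r n) x - mult_op b (adjoint_op H (mult_op b) (F (r n))) x) g"
      using J[unfolded compact_operator_def, THEN conjunct2, rule_format, of "\<lambda>n. A (F n)" C]
      unfolding A_def[symmetric] by simp
  qed
next
  assume q: "compact_form H (defect H (mult_op b))"
  have "\<exists>(r::nat \<Rightarrow> nat) g. strict_mono r \<and> converges_in H (\<lambda>n. F (r n)) g"
    if F: "\<forall>n. F n \<in> elts Hb \<and> fnorm Hb (F n) \<le> C" for F C
  proof -
    have FE: "F n \<in> elts H" "fnorm H (F n) \<le> C" for n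
      using F fnorm_le_Hb[of "F n"] Hb_subset by (auto intro: order_trans)
    then obtain r :: "nat \<Rightarrow> nat" where r: "strict_mono r"
      and small: "\<forall>e>0. \<exists>N. \<forall>m\<ge>N. \<forall>n\<ge>N. defect H (mult_op b) (\<lambda>x. F (r m) x - F (r n) x) < e"
      using q[unfolded compact_form_def] by blast
    have "C \<ge> 0" using FE fnorm_nonneg order_trans by blast
    have "\<exists>g. converges_in H (\<lambda>n. F (r n)) g"
    proof (rule complete)
      show "F (r n) \<in> elts H" for n using FE by blast
      fix e :: real assume "e > 0"
      \<comment> \<open>Chosen so that \<open>sqrt d * (2 * C + 1) = e\<^sup>2\<close>, where
        \<open>2 * C + 1\<close> strictly exceeds the \<open>Hb\<close>-norms of all
        differences.\<close>
      define d where "d = (e\<^sup>2 / (2 * C + 1))\<^sup>2"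
      have "e\<^sup>2 / (2 * C + 1) > 0" using \<open>C \<ge> 0\<close> \<open>e > 0\<close> by simp
      then have "d > 0" unfolding d_def by (rule zero_less_power)
      then obtain N where N: "\<And>m n. m \<ge> N \<Longrightarrow> n \<ge> N \<Longrightarrow>
          defect H (mult_op b) (\<lambda>x. F (r m) x - F (r n) x) < d"
        using small by meson
      have "fnorm H (\<lambda>x. F (r m) x - F (r n) x) < e" if mn: "m \<ge> N" "n \<ge> N" for m n
      proof (rule power2_less_imp_less)
        let ?g = "\<lambda>x. F (r m) x - F (r n) x"
        have g: "?g \<in> elts Hb" using F by simp
        have "fnorm Hb ?g \<le> fnorm Hb (F (r m)) + fnorm Hb (F (r n))"
          using F by (intro Hb.fnorm_triangle_diff) auto
        also have "\<dots> \<le> C + C" using F by (intro add_mono) auto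
        finally have "fnorm Hb ?g < 2 * C + 1" by simp
        have "sqrt (defect H (mult_op b) ?g) \<le> sqrt d"
          using N[OF mn] by simp
        also have "sqrt d = e\<^sup>2 / (2 * C + 1)"
          unfolding d_def using \<open>C \<ge> 0\<close> by simp
        finally have "sqrt (defect H (mult_op b) ?g) * fnorm Hb ?g \<le> e\<^sup>2 / (2 * C + 1) * fnorm Hb ?g"
          using Hb.fnorm_nonneg[OF g] by (rule mult_right_mono)
        also have "\<dots> < e\<^sup>2 / (2 * C + 1) * (2 * C + 1)"
          using \<open>fnorm Hb ?g < 2 * C + 1\<close> \<open>e\<^sup>2 / (2 * C + 1) > 0\<close> by (rule mult_strict_left_mono)
        also have "\<dots> = e\<^sup>2" using \<open>C \<ge> 0\<close> by simp
        finally show "(fnorm H ?g)\<^sup>2 < e\<^sup>2" using fnorm_power2_le_defect[OF g] by linarith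
      qed (use \<open>e > 0\<close> in simp)
      then show "\<exists>N. \<forall>m\<ge>N. \<forall>n\<ge>N. fnorm H (\<lambda>x. F (r m) x - F (r n) x) < e" by blast
    qed
    then show ?thesis using r by blast
  qed
  then show "compact_operator Hb H (\<lambda>f. f)"
    using Hb_subset by (auto simp: compact_operator_def linear_between_def)
qed

end

section \<open>Moebius factors and Blaschke products\<close>

definition mobius :: "complex \<Rightarrow> complex \<Rightarrow> complex" where
  "mobius a z = (z - a) / (1 - cnj a * z)"

lemma one_minus_cnj_mult_nonzero:
  assumes "cmod a < 1" "cmod z < 1"
  shows "1 - cnj a * z \<noteq> 0"
proof
  assume "1 - cnj a * z = 0"
  then have "cmod (cnj a * z) = 1" by simp
  moreover have "cmod a * cmod z < 1 * 1"
    using assms by (intro mult_strict_mono') auto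
  ultimately show False by (simp add: norm_mult)
qed

lemma resolvent_equation:
  assumes "cmod a < 1" "cmod z < 1"
  shows "w / (1 - cnj a * z) - cnj a * (z * (w / (1 - cnj a * z))) = w"
proof -
  have "x - cnj a * (z * x) = x * (1 - cnj a * z)" for x by (simp add: algebra_simps)
  from this[of "w / (1 - cnj a * z)"] show ?thesis
    using one_minus_cnj_mult_nonzero[OF assms] by (simp only: nonzero_eq_divide_eq times_divide_eq_left nonzero_mult_div_cancel_right not_False_eq_True)
qed

lemma adjoint_op_cong:
  "(\<And>f. f \<in> elts H \<Longrightarrow> T f = U f) \<Longrightarrow> adjoint_op H T = adjoint_op H U"
  unfolding adjoint_op_def by (intro ext arg_cong[where f = The]) auto

text \<open>The cross terms of the two expansions agree. With \<open>g = Z f\<close> this yields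
  contractivity of Moebius factors, and with \<open>g = adjoint_op H Z f\<close> their
  defect.\<close>

lemma (in hilbert_function_space) fnorm_mobius_identity:
  assumes "f \<in> elts H" "g \<in> elts H"
  shows "(fnorm H (\<lambda>x. f x - cnj a * g x))\<^sup>2 - (fnorm H (\<lambda>x. g x - a * f x))\<^sup>2
    = (1 - (cmod a)\<^sup>2) * ((fnorm H f)\<^sup>2 - (fnorm H g)\<^sup>2)"
proof -
  have "Re (inn H f (\<lambda>x. cnj a * g x)) = Re (inn H g (\<lambda>x. a * f x))"
    using assms inn_commute[of f g] by simp
  then show ?thesis
    using assms by (simp add: fnorm_diff_power2 fnorm_scale power_mult_distrib algebra_simps)
qed

locale disc_rkhs = rkhs "ball 0 1" H k for H :: "complex fun_space" and k +
  assumes id_Mult: "(\<lambda>z. z) \<in> Mult H" and id_contractive: "contractive_on H (mult_op (\<lambda>z. z))"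
begin

section \<open>Multiplication by z and its resolvents\<close>

abbreviation (input) "Z \<equiv> mult_op (\<lambda>z. z)"

lemma bounded_op_Z: "bounded_op H Z"
  using id_Mult id_contractive by (rule bounded_op_mult_op_contractive)

lemma Z_mem [simp]: "f \<in> elts H \<Longrightarrow> Z f \<in> elts H"
  using id_Mult by (rule Mult_mem)

lemma fnorm_Z_le: "f \<in> elts H \<Longrightarrow> fnorm H (Z f) \<le> fnorm H f"
  using id_contractive by (simp add: contractive_on_def)

lemma adjoint_Z_mem [simp]: "f \<in> elts H \<Longrightarrow> adjoint_op H Z f \<in> elts H"
  using bounded_op_Z by (rule adjoint_op_mem)

lemma fnorm_one_minus_ge:
  assumes "h \<in> elts H"
  shows "(1 - cmod a) * fnorm H h \<le> fnorm H (\<lambda>x. h x - cnj a * Z h x)"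
proof -
  have "fnorm H h \<le> fnorm H (\<lambda>x. h x - cnj a * Z h x) + cmod a * fnorm H (Z h)"
    using fnorm_triangle[of "\<lambda>x. h x - cnj a * Z h x" "\<lambda>x. cnj a * Z h x"] assms
    by (simp add: fnorm_scale)
  also have "cmod a * fnorm H (Z h) \<le> cmod a * fnorm H h"
    using fnorm_Z_le assms by (intro mult_left_mono) auto
  finally show ?thesis by (simp add: algebra_simps)
qed

text \<open>Neumann series: \<open>F n\<close> is the partial sum of the geometric series of
  \<open>cnj a * z\<close> applied to \<open>g\<close>, and its norm limit is identified by its
  values.\<close>

lemma resolvent:
  assumes a: "cmod a < 1" and g: "g \<in> elts H"
  shows "(\<lambda>z. g z / (1 - cnj a * z)) \<in> elts H"
proof -
  define P where "P n = (\<lambda>z. (cnj a * z) ^ n * g z)" for n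
  have P_Suc: "P (Suc n) = (\<lambda>z. cnj a * Z (P n) z)" for n
    by (simp add: P_def mult_op_def mult_ac)
  have P: "P n \<in> elts H \<and> fnorm H (P n) \<le> cmod a ^ n * fnorm H g" for n
  proof (induction n)
    case 0
    then show ?case using g by (simp add: P_def)
  next
    case (Suc n)
    then have "fnorm H (P (Suc n)) \<le> cmod a * fnorm H (P n)"
      using fnorm_Z_le[of "P n"] unfolding P_Suc by (simp add: fnorm_scale mult_left_mono)
    also have "\<dots> \<le> cmod a * (cmod a ^ n * fnorm H g)"
      using Suc by (intro mult_left_mono) auto
    finally show ?case using Suc by (simp add: P_Suc mult_ac)
  qed
  define F where "F n = (\<lambda>z. \<Sum>i<n. P i z)" for n
  have FE: "F n \<in> elts H" for n
    by (induction n) (auto simp: F_def P)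
  have eq: "F n z - cnj a * Z (F n) z = g z - P n z" for n z
  proof -
    have "F n z - cnj a * Z (F n) z = (1 - cnj a * z) * (\<Sum>i<n. (cnj a * z) ^ i) * g z"
      unfolding F_def P_def mult_op_def sum_distrib_right[symmetric] by (simp add: algebra_simps)
    then show ?thesis
      unfolding one_diff_power_eq[symmetric] by (simp add: P_def left_diff_distrib)
  qed
  \<comment> \<open>\<open>I - cnj a Z\<close> maps \<open>F m - F n\<close> to
    \<open>P n - P m\<close> and is bounded below by \<open>1 - cmod a\<close>.\<close>
  have diff: "(1 - cmod a) * fnorm H (\<lambda>z. F m z - F n z) \<le> (cmod a ^ m + cmod a ^ n) * fnorm H g" for m n
  proof -
    have "(1 - cmod a) * fnorm H (\<lambda>z. F m z - F n z)
        \<le> fnorm H (\<lambda>z. (F m z - F n z) - cnj a * Z (\<lambda>z. F m z - F n z) z)"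
      using FE by (intro fnorm_one_minus_ge) auto
    also have "(\<lambda>z. (F m z - F n z) - cnj a * Z (\<lambda>z. F m z - F n z) z) = (\<lambda>z. P n z - P m z)"
    proof
      fix z
      have "(F m z - F n z) - cnj a * Z (\<lambda>z. F m z - F n z) z
          = (F m z - cnj a * Z (F m) z) - (F n z - cnj a * Z (F n) z)"
        by (simp add: mult_op_def algebra_simps)
      then show "(F m z - F n z) - cnj a * Z (\<lambda>z. F m z - F n z) z = P n z - P m z"
        unfolding eq by simp
    qed
    also have "fnorm H (\<lambda>z. P n z - P m z) \<le> fnorm H (P n) + fnorm H (P m)"
      using P by (intro fnorm_triangle_diff) auto
    also have "\<dots> \<le> (cmod a ^ m + cmod a ^ n) * fnorm H g"
      using P[of m] P[of n] by (simp add: algebra_simps)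
    finally show ?thesis .
  qed
  have "\<exists>h. converges_in H F h"
  proof (rule complete[OF FE])
    fix e :: real assume "e > 0"
    define d where "d = (1 - cmod a) * e / 2"
    have "d > 0" using a \<open>e > 0\<close> by (simp add: d_def)
    have "(\<lambda>n. cmod a ^ n * fnorm H g) \<longlonglongrightarrow> 0"
      using a by (intro tendsto_mult_left_zero LIMSEQ_power_zero) simp
    then have "\<forall>\<^sub>F n in sequentially. cmod a ^ n * fnorm H g < d"
      using \<open>d > 0\<close> by (rule order_tendstoD)
    then obtain N where N: "\<And>n. n \<ge> N \<Longrightarrow> cmod a ^ n * fnorm H g < d"
      by (auto simp: eventually_sequentially)
    have "fnorm H (\<lambda>z. F m z - F n z) < e" if "m \<ge> N" "n \<ge> N" for m n
    proof -
      have "(1 - cmod a) * fnorm H (\<lambda>z. F m z - F n z) < d + d"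
        using diff[of m n] N[OF that(1)] N[OF that(2)] by (simp add: distrib_right)
      also have "d + d = (1 - cmod a) * e" by (simp add: d_def)
      finally show ?thesis using a by simp
    qed
    then show "\<exists>N. \<forall>m\<ge>N. \<forall>n\<ge>N. fnorm H (\<lambda>z. F m z - F n z) < e" by blast
  qed
  then obtain h where h: "converges_in H F h" by blast
  have "h = (\<lambda>z. g z / (1 - cnj a * z))"
  proof
    fix z
    show "h z = g z / (1 - cnj a * z)"
    proof (cases "z \<in> ball 0 1")
      case True
      then have z: "cmod z < 1" by simp
      then have ne: "1 - cnj a * z \<noteq> 0" using a by (intro one_minus_cnj_mult_nonzero)
      have "cmod a * cmod z < 1 * 1" using a z by (intro mult_strict_mono') auto
      then have "cmod (cnj a * z) < 1" by (simp add: norm_mult)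
      then have "(\<lambda>n. (cnj a * z) ^ n * g z) \<longlonglongrightarrow> 0"
        by (intro tendsto_mult_left_zero LIMSEQ_power_zero)
      then have "(\<lambda>n. (g z - P n z) / (1 - cnj a * z)) \<longlonglongrightarrow> (g z - 0) / (1 - cnj a * z)"
        unfolding P_def using ne by (intro tendsto_intros)
      moreover have "F n z = (g z - P n z) / (1 - cnj a * z)" for n
        using eq[of n z] ne by (simp add: mult_op_def field_simps)
      ultimately show ?thesis
        using converges_in_pointwise[OF FE h, of z] by (simp add: LIMSEQ_unique)
    next
      case False
      moreover have "h \<in> elts H" using h by (simp add: converges_in_def)
      ultimately show ?thesis using supported[of h z] supported[OF g, of z] by simp
    qed
  qed
  then show ?thesis using h by (simp add: converges_in_def)
qed

text \<open>Outside the disc the denominator may vanish, but there \<open>g z = 0\<close> and both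
  sides are zero.\<close>

lemma resolvent_identity:
  assumes "cmod a < 1" "g \<in> elts H"
  shows "g z / (1 - cnj a * z) - cnj a * (z * (g z / (1 - cnj a * z))) = g z"
  using resolvent_equation[OF assms(1), of z "g z"] supported[OF assms(2), of z]
  by (cases "cmod z < 1") auto

lemma fnorm_resolvent_le:
  assumes a: "cmod a < 1" and g: "g \<in> elts H"
  shows "fnorm H (\<lambda>z. g z / (1 - cnj a * z)) \<le> 1 / (1 - cmod a) * fnorm H g"
proof -
  let ?h = "\<lambda>z. g z / (1 - cnj a * z)"
  have "(\<lambda>z. ?h z - cnj a * Z ?h z) = g"
    unfolding mult_op_def using resolvent_identity[OF a g] by blast
  then have "(1 - cmod a) * fnorm H ?h \<le> fnorm H g"
    using fnorm_one_minus_ge[OF resolvent[OF a g], of a] by simp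
  then show ?thesis using a by (simp add: field_simps)
qed

section \<open>Moebius multipliers and their defects\<close>

lemma mult_op_mobius:
  "mult_op (mobius a) g = (\<lambda>z. Z (\<lambda>z. g z / (1 - cnj a * z)) z - a * (g z / (1 - cnj a * z)))"
  by (simp add: mult_op_def mobius_def fun_eq_iff diff_divide_distrib algebra_simps)

lemma mobius_Mult:
  assumes "cmod a < 1"
  shows "mobius a \<in> Mult H"
  unfolding Mult_def
proof (intro CollectI ballI)
  fix g assume "g \<in> elts H"
  from resolvent[OF assms this] show "mult_op (mobius a) g \<in> elts H"
    unfolding mult_op_mobius by (intro diff_mem Z_mem scale_mem)
qed

text \<open>The denominator is cleared, so that adjoints involve only \<open>Z\<close> and the
  Moebius multiplier.\<close>

lemma one_minus_mult_mobius:
  assumes "cmod a < 1" and g: "g \<in> elts H"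
  shows "mult_op (mobius a) g z - cnj a * Z (mult_op (mobius a) g) z = Z g z - a * g z"
proof (cases "cmod z < 1")
  case True
  then have "1 - cnj a * z \<noteq> 0" using assms by (intro one_minus_cnj_mult_nonzero)
  then have "mobius a z * (1 - cnj a * z) = z - a" by (simp add: mobius_def)
  then have "mobius a z * (1 - cnj a * z) * g z = (z - a) * g z" by simp
  then show ?thesis by (simp add: mult_op_def algebra_simps)
next
  case False
  then show ?thesis using supported[OF g, of z] by (simp add: mult_op_def)
qed

text \<open>Write \<open>g = h - cnj a Z h\<close> with \<open>h\<close> the resolvent of
  \<open>g\<close>; then the Moebius multiplier sends \<open>g\<close> to \<open>Z h - a h\<close>,
  and \<open>fnorm_mobius_identity\<close> reduces the claim to contractivity of
  \<open>Z\<close>.\<close>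

lemma mobius_contractive:
  assumes a: "cmod a < 1"
  shows "contractive_on H (mult_op (mobius a))"
  unfolding contractive_on_def
proof
  fix g assume g: "g \<in> elts H"
  let ?h = "\<lambda>z. g z / (1 - cnj a * z)"
  have h: "?h \<in> elts H" using a g by (rule resolvent)
  have "(\<lambda>z. ?h z - cnj a * Z ?h z) = g"
    unfolding mult_op_def using resolvent_identity[OF a g] by blast
  then have "(fnorm H g)\<^sup>2 - (fnorm H (mult_op (mobius a) g))\<^sup>2
      = (1 - (cmod a)\<^sup>2) * ((fnorm H ?h)\<^sup>2 - (fnorm H (Z ?h))\<^sup>2)"
    using fnorm_mobius_identity[OF h Z_mem[OF h], of a] unfolding mult_op_mobius by simp
  also have "\<dots> \<ge> 0"
    using a h fnorm_Z_le[OF h]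
    by (intro mult_nonneg_nonneg) (auto simp: power_le_one intro: power_mono)
  finally have "(fnorm H (mult_op (mobius a) g))\<^sup>2 \<le> (fnorm H g)\<^sup>2" by simp
  then show "fnorm H (mult_op (mobius a) g) \<le> fnorm H g"
    by (rule power2_le_imp_le) (use g in simp)
qed

lemma bounded_op_mobius: "cmod a < 1 \<Longrightarrow> bounded_op H (mult_op (mobius a))"
  using mobius_Mult mobius_contractive by (rule bounded_op_mult_op_contractive)

text \<open>Take adjoints in \<open>(I - cnj a Z) M = Z - a\<close>, where \<open>M\<close> is
  multiplication by \<open>mobius a\<close>.\<close>

lemma adjoint_mobius:
  assumes a: "cmod a < 1" and u: "u \<in> elts H"
  shows "adjoint_op H (mult_op (mobius a)) (\<lambda>x. u x - a * adjoint_op H Z u x)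
    = (\<lambda>x. adjoint_op H Z u x - cnj a * u x)"
proof (rule adjoint_op_eqI)
  show "(\<lambda>x. adjoint_op H Z u x - cnj a * u x) \<in> elts H" using u by simp
next
  fix g assume g: "g \<in> elts H"
  let ?h = "mult_op (mobius a) g"
  have h: "?h \<in> elts H" using bounded_op_mobius[OF a] g by (rule bounded_op_mem)
  have "inn H ?h (\<lambda>x. u x - a * adjoint_op H Z u x) = inn H (\<lambda>x. ?h x - cnj a * Z ?h x) u"
    using u h by (simp add: inn_adjoint_op[OF bounded_op_Z])
  also have "(\<lambda>x. ?h x - cnj a * Z ?h x) = (\<lambda>x. Z g x - a * g x)"
    using one_minus_mult_mobius[OF a g] by simp
  also have "inn H (\<lambda>x. Z g x - a * g x) u = inn H g (\<lambda>x. adjoint_op H Z u x - cnj a * u x)"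
    using u g by (simp add: inn_adjoint_op[OF bounded_op_Z])
  finally show "inn H ?h (\<lambda>x. u x - a * adjoint_op H Z u x)
    = inn H g (\<lambda>x. adjoint_op H Z u x - cnj a * u x)" .
qed

lemma defect_mobius:
  assumes a: "cmod a < 1" and u: "u \<in> elts H"
  shows "defect H (mult_op (mobius a)) (\<lambda>x. u x - a * adjoint_op H Z u x)
    = (1 - (cmod a)\<^sup>2) * defect H Z u"
  using fnorm_mobius_identity[OF u adjoint_Z_mem[OF u], of "cnj a"]
  by (simp add: defect_def adjoint_mobius[OF assms])

text \<open>By \<open>defect_mobius\<close> the two forms agree up to a positive factor after
  substituting \<open>u - a * adjoint_op H Z u\<close>. One direction composes with this bounded
  map, the other with a bounded right inverse of it.\<close>

lemma compact_form_mobius_iff: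
  assumes a: "cmod a < 1"
  shows "compact_form H (defect H (mult_op (mobius a))) \<longleftrightarrow> compact_form H (defect H Z)"
proof (rule iffI)
  have pos: "1 - (cmod a)\<^sup>2 > 0" using a by (simp add: power_less_one_iff)
  let ?R = "\<lambda>u x. u x - a * adjoint_op H Z u x"
  assume "compact_form H (defect H (mult_op (mobius a)))"
  then have "compact_form H (\<lambda>u. defect H (mult_op (mobius a)) (?R u))"
  proof (rule compact_form_comp[where R = ?R and K = "1 + cmod a"])
    fix f assume f: "f \<in> elts H"
    have "fnorm H (\<lambda>x. f x - a * adjoint_op H Z f x)
        \<le> fnorm H f + cmod a * fnorm H (adjoint_op H Z f)"
      using fnorm_triangle_diff[of f "\<lambda>x. a * adjoint_op H Z f x"] f by (simp add: fnorm_scale)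
    also have "cmod a * fnorm H (adjoint_op H Z f) \<le> cmod a * fnorm H f"
      using contractive_adjoint_op[OF bounded_op_Z id_contractive f] by (rule mult_left_mono) simp
    finally show "fnorm H (?R f) \<le> (1 + cmod a) * fnorm H f"
      by (simp add: algebra_simps)
  qed (simp_all add: adjoint_op_diff[OF bounded_op_Z] algebra_simps)
  then show "compact_form H (defect H Z)"
    by (rule compact_form_le[where c = "1 / (1 - (cmod a)\<^sup>2)"])
      (use pos in \<open>simp_all add: defect_mobius[OF a]\<close>)
next
  have pos: "1 - (cmod a)\<^sup>2 > 0" using a by (simp add: power_less_one_iff)
  \<comment> \<open>The adjoint of this resolvent multiplier is the right inverse.\<close>
  define \<psi> where "\<psi> = (\<lambda>z. 1 / (1 - cnj a * z))"
  have psi: "mult_op \<psi> = (\<lambda>g z. g z / (1 - cnj a * z))"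
    by (simp add: \<psi>_def mult_op_def fun_eq_iff)
  have psi_bound: "fnorm H (mult_op \<psi> f) \<le> 1 / (1 - cmod a) * fnorm H f" if "f \<in> elts H" for f
    unfolding psi using a that by (rule fnorm_resolvent_le)
  have "\<psi> \<in> Mult H" by (simp add: Mult_def psi resolvent[OF a])
  from bounded_op_mult_op[OF this psi_bound] have bpsi: "bounded_op H (mult_op \<psi>)" .
  let ?R = "adjoint_op H (mult_op \<psi>)"
  have inverse: "(\<lambda>x. ?R f x - a * adjoint_op H Z (?R f) x) = f" if f: "f \<in> elts H" for f
  proof (rule ext_inn)
    let ?u = "?R f"
    have u: "?u \<in> elts H" using bpsi f by (rule adjoint_op_mem)
    show "(\<lambda>x. ?u x - a * adjoint_op H Z ?u x) \<in> elts H" using u by simp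
    fix g assume g: "g \<in> elts H"
    have mem: "mult_op \<psi> g \<in> elts H" "mult_op \<psi> (Z g) \<in> elts H"
      using g by (simp_all add: bounded_op_mem[OF bpsi])
    have "inn H g (\<lambda>x. ?u x - a * adjoint_op H Z ?u x)
        = inn H (\<lambda>x. mult_op \<psi> g x - cnj a * mult_op \<psi> (Z g) x) f"
      using g u f mem by (simp add: inn_adjoint_op[OF bounded_op_Z] inn_adjoint_op[OF bpsi])
    also have "(\<lambda>x. mult_op \<psi> g x - cnj a * mult_op \<psi> (Z g) x) = g"
    proof
      fix x show "mult_op \<psi> g x - cnj a * mult_op \<psi> (Z g) x = g x"
        using resolvent_identity[OF a g, of x] by (simp add: psi mult_op_def)
    qed
    finally show "inn H g (\<lambda>x. ?u x - a * adjoint_op H Z ?u x) = inn H g f" .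
  qed (use f in simp)
  assume "compact_form H (defect H Z)"
  then have "compact_form H (\<lambda>f. defect H Z (?R f))"
  proof (rule compact_form_comp[where R = ?R and K = "1 / (1 - cmod a)"])
    show "?R f \<in> elts H" if "f \<in> elts H" for f using bpsi that by (rule adjoint_op_mem)
    show "fnorm H (?R f) \<le> 1 / (1 - cmod a) * fnorm H f" if "f \<in> elts H" for f
      using a that by (intro fnorm_adjoint_op_le[OF bpsi psi_bound]) auto
  qed (use a in \<open>simp_all add: adjoint_op_diff[OF bpsi]\<close>)
  then show "compact_form H (defect H (mult_op (mobius a)))"
  proof (rule compact_form_le)
    fix f assume f: "f \<in> elts H"
    show "defect H (mult_op (mobius a)) f \<le> (1 - (cmod a)\<^sup>2) * defect H Z (?R f)"
      using defect_mobius[OF a adjoint_op_mem[OF bpsi f]] inverse[OF f] by simp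
  qed (use pos in simp_all)
qed

section \<open>Finite Blaschke products as multipliers\<close>

definition blaschke :: "complex \<Rightarrow> complex list \<Rightarrow> complex \<Rightarrow> complex" where
  "blaschke c as = (\<lambda>z. c * (\<Prod>a\<leftarrow>as. mobius a z))"

lemma mult_op_blaschke_Cons:
  "mult_op (blaschke c (a # as)) = (\<lambda>g. mult_op (mobius a) (mult_op (blaschke c as) g))"
  by (simp add: blaschke_def mult_op_def mult_ac fun_eq_iff)

lemma blaschke_multiplier:
  assumes c: "cmod c = 1" and "set as \<subseteq> ball 0 1"
  shows "blaschke c as \<in> Mult H \<and> contractive_on H (mult_op (blaschke c as))"
  using assms(2)
proof (induction as)
  case Nil
  then show ?case
    using c by (simp add: blaschke_def Mult_def contractive_on_def mult_op_def fnorm_scale)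
next
  case (Cons a as)
  then have a: "cmod a < 1" and IH: "blaschke c as \<in> Mult H" "contractive_on H (mult_op (blaschke c as))"
    by auto
  have "mult_op (blaschke c (a # as)) g \<in> elts H \<and> fnorm H (mult_op (blaschke c (a # as)) g) \<le> fnorm H g"
    if g: "g \<in> elts H" for g
    unfolding mult_op_blaschke_Cons
    using Mult_mem[OF IH(1) g] Mult_mem[OF mobius_Mult[OF a]] mobius_contractive[OF a] IH(2) g
    by (auto simp: contractive_on_def intro: order_trans)
  then show ?case by (simp add: Mult_def contractive_on_def)
qed

lemma defect_blaschke_Cons:
  assumes "cmod c = 1" "set (a # as) \<subseteq> ball 0 1" "f \<in> elts H"
  shows "defect H (mult_op (blaschke c (a # as))) f = defect H (mult_op (mobius a)) f
    + defect H (mult_op (blaschke c as)) (adjoint_op H (mult_op (mobius a)) f)"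
  unfolding mult_op_blaschke_Cons
  using assms blaschke_multiplier[of c as]
  by (intro defect_comp bounded_op_mobius bounded_op_mult_op_contractive) auto

text \<open>Induction on the list of zeros: each further factor adds the form of one Moebius factor
  and composes the previous form with a contraction.\<close>

lemma compact_form_blaschke:
  assumes q: "compact_form H (defect H Z)" and c: "cmod c = 1" and "set as \<subseteq> ball 0 1"
  shows "compact_form H (defect H (mult_op (blaschke c as)))"
  using assms(3)
proof (induction as)
  case Nil
  \<comment> \<open>Multiplication by a unimodular constant has an isometric adjoint, so its defect
    vanishes.\<close>
  have "adjoint_op H (mult_op (blaschke c [])) f = (\<lambda>x. cnj c * f x)" if "f \<in> elts H" for f
    using that by (intro adjoint_op_eqI) (auto simp: blaschke_def mult_op_def)
  then have "defect H (mult_op (blaschke c [])) f \<le> 1 * 0" if "f \<in> elts H" for f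
    using that c by (simp add: defect_def fnorm_scale)
  moreover have "compact_form H (\<lambda>f. 0)"
    unfolding compact_form_def using strict_mono_id by auto
  ultimately show ?case using compact_form_le[of H "\<lambda>f. 0" _ 1] by simp
next
  case (Cons a as)
  then have a: "cmod a < 1" by simp
  let ?R = "adjoint_op H (mult_op (mobius a))"
  have "compact_form H (defect H (mult_op (blaschke c as)))" using Cons by simp
  then have "compact_form H (\<lambda>f. defect H (mult_op (blaschke c as)) (?R f))"
  proof (rule compact_form_comp[where R = ?R and K = 1])
    show "?R f \<in> elts H" if "f \<in> elts H" for f
      using bounded_op_mobius[OF a] that by (rule adjoint_op_mem)
    show "fnorm H (?R f) \<le> 1 * fnorm H f" if "f \<in> elts H" for f
      using contractive_adjoint_op[OF bounded_op_mobius[OF a] mobius_contractive[OF a] that] by simp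
  qed (simp_all add: adjoint_op_diff[OF bounded_op_mobius[OF a]])
  with q compact_form_mobius_iff[OF a]
  have "compact_form H (\<lambda>f. defect H (mult_op (mobius a)) f
      + defect H (mult_op (blaschke c as)) (?R f))"
    by (intro compact_form_add) blast+
  then show ?case
    by (rule compact_form_le[where c = 1]) (use defect_blaschke_Cons[OF c Cons.prems] in simp_all)
qed

text \<open>One factor suffices: dropping the nonnegative form of the remaining factors bounds the
  form of \<open>mobius a\<close> by that of the whole product.\<close>

lemma compact_form_Z_if_blaschke:
  assumes q: "compact_form H (defect H (mult_op (blaschke c (a # as))))"
    and c: "cmod c = 1" and as: "set (a # as) \<subseteq> ball 0 1"
  shows "compact_form H (defect H Z)"
proof -
  have a: "cmod a < 1" using as by simp
  have "compact_form H (defect H (mult_op (mobius a)))"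
    using q
  proof (rule compact_form_le[where c = 1])
    fix f assume f: "f \<in> elts H"
    have "0 \<le> defect H (mult_op (blaschke c as)) (adjoint_op H (mult_op (mobius a)) f)"
      using blaschke_multiplier[OF c, of as] as f
      by (intro defect_nonneg bounded_op_mult_op_contractive adjoint_op_mem bounded_op_mobius a) auto
    then show "defect H (mult_op (mobius a)) f \<le> 1 * defect H (mult_op (blaschke c (a # as))) f"
      using defect_blaschke_Cons[OF c as f] by simp
  qed auto
  then show ?thesis using compact_form_mobius_iff[OF a] by simp
qed

text \<open>Elements of \<open>H\<close> vanish off the disc, so values of a multiplier there do not
  affect the operator.\<close>

lemma defect_cong_on_disc:
  assumes "\<And>z. z \<in> ball 0 1 \<Longrightarrow> \<phi> z = \<psi> z"
  shows "defect H (mult_op \<phi>) = defect H (mult_op \<psi>)"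
proof -
  have "mult_op \<phi> f = mult_op \<psi> f" if "f \<in> elts H" for f
    using assms supported[OF that] by (fastforce simp: mult_op_def)
  then have "adjoint_op H (mult_op \<phi>) = adjoint_op H (mult_op \<psi>)" by (rule adjoint_op_cong)
  then show ?thesis by (intro ext) (simp add: defect_def)
qed

end

section \<open>Holomorphic functions of unimodular boundary modulus\<close>

text \<open>Approach to the circle from inside, uniformly in the argument.\<close>

abbreviation (input) to_circle :: "complex filter" where
  "to_circle \<equiv> filtercomap cmod (at_left 1)"

lemma eventually_to_circle:
  "eventually P to_circle \<longleftrightarrow> (\<exists>r. 0 < r \<and> r < 1 \<and> (\<forall>z. r < cmod z \<longrightarrow> cmod z < 1 \<longrightarrow> P z))"
proof
  assume "eventually P to_circle"
  then obtain Q where Q: "eventually Q (at_left 1)" "\<And>z. Q (cmod z) \<Longrightarrow> P z"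
    unfolding eventually_filtercomap by blast
  obtain r where "r < 1" "\<And>x. r < x \<Longrightarrow> x < 1 \<Longrightarrow> Q x"
    using Q(1) eventually_at_left[of "0::real" 1] by auto
  then show "\<exists>r. 0 < r \<and> r < 1 \<and> (\<forall>z. r < cmod z \<longrightarrow> cmod z < 1 \<longrightarrow> P z)"
    using Q(2) by (intro exI[of _ "max r (1/2)"]) auto
next
  assume "\<exists>r. 0 < r \<and> r < 1 \<and> (\<forall>z. r < cmod z \<longrightarrow> cmod z < 1 \<longrightarrow> P z)"
  then obtain r where r: "r < 1" "\<And>z. r < cmod z \<Longrightarrow> cmod z < 1 \<Longrightarrow> P z" by blast
  have "eventually (\<lambda>x. r < x \<and> x < 1) (at_left 1)"
    using r(1) eventually_at_left[of "0::real" 1] by auto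
  then show "eventually P to_circle" unfolding eventually_filtercomap using r(2) by blast
qed

lemma tendsto_cmod_to_circle: "(cmod \<longlongrightarrow> 1) to_circle"
  using filterlim_compose[OF _ filterlim_filtercomap, of "\<lambda>x. x" "nhds 1" "at_left (1::real)" cmod]
  by (simp add: filterlim_at_within_not_equal tendsto_ident_at)

lemma norm_le_1_if_tendsto_1_to_circle:
  assumes holo: "g holomorphic_on ball 0 1" and lim: "((\<lambda>z. cmod (g z)) \<longlongrightarrow> 1) to_circle"
    and z: "cmod z < 1"
  shows "cmod (g z) \<le> 1"
proof (rule field_le_epsilon)
  fix e :: real assume "e > 0"
  then have "\<forall>\<^sub>F w in to_circle. cmod (g w) < 1 + e"
    using order_tendstoD(2)[OF lim, of "1 + e"] by simp
  then obtain r where r: "r < 1" "\<And>w. r < cmod w \<Longrightarrow> cmod w < 1 \<Longrightarrow> cmod (g w) < 1 + e"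
    unfolding eventually_to_circle by blast
  \<comment> \<open>The circle of radius \<open>s\<close> encloses \<open>z\<close> and lies where
    the modulus of \<open>g\<close> is already below \<open>1 + e\<close>.\<close>
  obtain s where s: "max r (cmod z) < s" "s < 1" using r z dense[of "max r (cmod z)" 1] by auto
  have "0 < s" using s(1) norm_ge_zero[of z] by linarith
  have sub: "cball 0 s \<subseteq> (ball 0 1 :: complex set)" using s by auto
  show "cmod (g z) \<le> 1 + e"
  proof (rule maximum_modulus_frontier[of g "ball 0 s"])
    show "g holomorphic_on interior (ball 0 s)"
      using holo sub by (auto elim!: holomorphic_on_subset)
    show "continuous_on (closure (ball 0 s)) g"
      using holomorphic_on_imp_continuous_on[OF holo] sub \<open>0 < s\<close> by (auto elim: continuous_on_subset)
    show "cmod (g w) \<le> 1 + e" if "w \<in> frontier (ball 0 s)" for w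
      using that s \<open>0 < s\<close> r(2)[of w] by (simp add: less_imp_le)
  qed (use s in auto)
qed

text \<open>This identity serves twice: for the boundary limit of a Moebius factor, and for bounding
  it away from 1 at a fixed interior point.\<close>

lemma cmod_mobius_power2:
  assumes "cmod a < 1" "cmod z < 1"
  shows "1 - (cmod (mobius a z))\<^sup>2
    = (1 - (cmod a)\<^sup>2) * (1 - (cmod z)\<^sup>2) / (cmod (1 - cnj a * z))\<^sup>2"
proof -
  have "(cmod (z - a))\<^sup>2 = (cmod (1 - cnj a * z))\<^sup>2 - (1 - (cmod a)\<^sup>2) * (1 - (cmod z)\<^sup>2)"
    by (simp only: cmod_power2) (simp add: power2_eq_square algebra_simps)
  moreover have "(cmod (1 - cnj a * z))\<^sup>2 \<noteq> 0"
    using one_minus_cnj_mult_nonzero[OF assms] by simp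
  ultimately show ?thesis
    unfolding mobius_def norm_divide power_divide by (simp add: diff_divide_distrib)
qed

text \<open>The denominator in \<open>cmod_mobius_power2\<close> is at least
  \<open>(1 - cmod a)\<^sup>2\<close>, which squeezes the squared modulus towards 1.\<close>

lemma tendsto_mobius_to_circle:
  assumes a: "cmod a < 1"
  shows "((\<lambda>z. cmod (mobius a z)) \<longlongrightarrow> 1) to_circle"
proof -
  let ?c = "(1 - (cmod a)\<^sup>2) / (1 - cmod a)\<^sup>2"
  have c: "1 - (cmod a)\<^sup>2 > 0" using a by (simp add: power_less_one_iff)
  have "((\<lambda>z. (cmod (mobius a z))\<^sup>2) \<longlongrightarrow> 1) to_circle"
  proof (rule tendsto_sandwich)
    have ev: "0 \<le> 1 - (cmod (mobius a z))\<^sup>2 \<and> 1 - (cmod (mobius a z))\<^sup>2 \<le> ?c * (1 - (cmod z)\<^sup>2)"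
      if z: "cmod z < 1" for z
    proof -
      have z2: "1 - (cmod z)\<^sup>2 \<ge> 0" using z by (simp add: power_le_one)
      have "cmod (cnj a * z) \<le> cmod a"
        using z by (simp add: norm_mult mult_left_le)
      then have "1 - cmod a \<le> cmod (1 - cnj a * z)"
        using norm_triangle_ineq2[of 1 "cnj a * z"] by simp
      then have "(1 - cmod a)\<^sup>2 \<le> (cmod (1 - cnj a * z))\<^sup>2" using a by (intro power_mono) auto
      then have "(1 - (cmod a)\<^sup>2) * (1 - (cmod z)\<^sup>2) / (cmod (1 - cnj a * z))\<^sup>2
          \<le> (1 - (cmod a)\<^sup>2) * (1 - (cmod z)\<^sup>2) / (1 - cmod a)\<^sup>2"
        using a c z2 by (intro divide_left_mono mult_nonneg_nonneg mult_pos_pos) auto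
      then show ?thesis using cmod_mobius_power2[OF a z] c z2 by simp
    qed
    show "\<forall>\<^sub>F z in to_circle. 1 - ?c * (1 - (cmod z)\<^sup>2) \<le> (cmod (mobius a z))\<^sup>2"
      unfolding eventually_to_circle using ev by (intro exI[of _ "1/2"]) force
    show "\<forall>\<^sub>F z in to_circle. (cmod (mobius a z))\<^sup>2 \<le> 1"
      unfolding eventually_to_circle using ev by (intro exI[of _ "1/2"]) force
    have "((\<lambda>z. 1 - ?c * (1 - (cmod z)\<^sup>2)) \<longlongrightarrow> 1 - ?c * (1 - 1\<^sup>2)) to_circle"
      by (intro tendsto_intros tendsto_cmod_to_circle)
    then show "((\<lambda>z. 1 - ?c * (1 - (cmod z)\<^sup>2)) \<longlongrightarrow> 1) to_circle" by simp
  qed simp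
  from tendsto_real_sqrt[OF this] show ?thesis by simp
qed

text \<open>The quotient is the difference quotient of \<open>g\<close> at \<open>a\<close>, with
  its singularity removed, times the Moebius denominator. Its boundary modulus is unchanged because
  that of the Moebius factor tends to 1.\<close>

lemma divide_out_zero:
  assumes holo: "g holomorphic_on ball 0 1" and lim: "((\<lambda>z. cmod (g z)) \<longlongrightarrow> 1) to_circle"
    and a: "cmod a < 1" and "g a = 0"
  obtains h where "h holomorphic_on ball 0 1" "((\<lambda>z. cmod (h z)) \<longlongrightarrow> 1) to_circle"
    "\<And>z. cmod z < 1 \<Longrightarrow> g z = mobius a z * h z"
proof -
  define h where "h z = (if z = a then deriv g a else (g z - g a) / (z - a)) * (1 - cnj a * z)" for z
  have eq: "g z = mobius a z * h z" if "cmod z < 1" for z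
    using one_minus_cnj_mult_nonzero[OF a that] \<open>g a = 0\<close> by (simp add: h_def mobius_def)
  have "h holomorphic_on ball 0 1"
    unfolding h_def using a by (intro holomorphic_on_mult pole_lemma holo) (auto intro!: holomorphic_intros)
  moreover have "((\<lambda>z. cmod (h z)) \<longlongrightarrow> 1) to_circle"
  proof (rule Lim_transform_eventually)
    show "((\<lambda>z. cmod (g z) / cmod (mobius a z)) \<longlongrightarrow> 1) to_circle"
      using tendsto_divide[OF lim tendsto_mobius_to_circle[OF a]] by simp
    have "\<forall>\<^sub>F z in to_circle. cmod (mobius a z) > 0"
      using order_tendstoD(1)[OF tendsto_mobius_to_circle[OF a], of 0] by simp
    moreover have "\<forall>\<^sub>F z in to_circle. cmod z < 1"
      unfolding eventually_to_circle by (intro exI[of _ "1/2"]) simp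
    ultimately show "\<forall>\<^sub>F z in to_circle. cmod (g z) / cmod (mobius a z) = cmod (h z)"
      by eventually_elim (simp add: eq norm_mult)
  qed
  ultimately show ?thesis using that eq by blast
qed

text \<open>Factors are divided out until none is left. This ends, because at a fixed point \<open>z0\<close> each
  factor with zero in \<open>cball 0 r\<close> has modulus at most a constant \<open>\<rho> < 1\<close>.\<close>

lemma finite_blaschke_product_if_tendsto_1_to_circle:
  assumes holo: "b holomorphic_on ball 0 1" and lim: "((\<lambda>z. cmod (b z)) \<longlongrightarrow> 1) to_circle"
  shows "finite_blaschke_product b"
proof -
  have "\<forall>\<^sub>F z in to_circle. cmod (b z) > 0" using order_tendstoD(1)[OF lim, of 0] by simp
  then obtain r where r: "0 < r" "r < 1" "\<And>z. r < cmod z \<Longrightarrow> cmod z < 1 \<Longrightarrow> b z \<noteq> 0"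
    unfolding eventually_to_circle by auto
  \<comment> \<open>\<open>P n\<close> says that \<open>n\<close> factors with zeros in
    \<open>cball 0 r\<close> split off, leaving a holomorphic cofactor of boundary modulus
    1.\<close>
  define P where "P n \<longleftrightarrow> (\<exists>as g. length as = n \<and> set as \<subseteq> cball 0 r \<and> g holomorphic_on ball 0 1 \<and>
      ((\<lambda>z. cmod (g z)) \<longlongrightarrow> 1) to_circle \<and> (\<forall>z. cmod z < 1 \<longrightarrow> b z = (\<Prod>a\<leftarrow>as. mobius a z) * g z))"
    for n
  have "P 0" unfolding P_def using holo lim by (intro exI[of _ "[]"] exI[of _ b]) simp
  define z0 :: complex where "z0 = of_real ((r + 1) / 2)"
  have z0: "r < cmod z0" "cmod z0 < 1" using r by (auto simp: z0_def simp del: of_real_divide of_real_add)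
  \<comment> \<open>From \<open>cmod_mobius_power2\<close>, with \<open>cmod a \<le> r\<close> in
    the numerator and the denominator at most 4.\<close>
  define \<rho> where "\<rho> = sqrt (1 - (1 - r\<^sup>2) * (1 - (cmod z0)\<^sup>2) / 4)"
  have pos: "1 - r\<^sup>2 > 0" "1 - (cmod z0)\<^sup>2 > 0" using r z0 by (auto simp: power_less_one_iff)
  have rho: "0 \<le> \<rho>" "\<rho> < 1"
  proof -
    have "(1 - r\<^sup>2) * (1 - (cmod z0)\<^sup>2) \<le> 1 * 1" using pos by (intro mult_mono) auto
    then show "0 \<le> \<rho>" by (simp add: \<rho>_def)
    show "\<rho> < 1" using pos by (simp add: \<rho>_def)
  qed
  have mob: "cmod (mobius a z0) \<le> \<rho>" if a: "a \<in> cball 0 r" for a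
  proof -
    have a': "cmod a < 1" "cmod a \<le> r" using a r by auto
    have "cmod (1 - cnj a * z0) \<le> 1 + cmod (cnj a * z0)" using norm_triangle_ineq4[of 1 "cnj a * z0"] by simp
    also have "cmod (cnj a * z0) \<le> 1 * 1"
      unfolding norm_mult using a' z0 by (intro mult_mono) auto
    finally have "(cmod (1 - cnj a * z0))\<^sup>2 \<le> 2\<^sup>2" by (intro power_mono) auto
    moreover have "1 - r\<^sup>2 \<le> 1 - (cmod a)\<^sup>2" using a' by (simp add: power_mono)
    moreover have "0 < (cmod (1 - cnj a * z0))\<^sup>2" using one_minus_cnj_mult_nonzero[OF a'(1) z0(2)] by simp
    ultimately have "(1 - r\<^sup>2) * (1 - (cmod z0)\<^sup>2) / 4 \<le> 1 - (cmod (mobius a z0))\<^sup>2"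
      unfolding cmod_mobius_power2[OF a'(1) z0(2)] using pos by (intro frac_le mult_right_mono mult_nonneg_nonneg) auto
    then have "(cmod (mobius a z0))\<^sup>2 \<le> 1 - (1 - r\<^sup>2) * (1 - (cmod z0)\<^sup>2) / 4"
      by linarith
    then show ?thesis unfolding \<rho>_def by (rule real_le_rsqrt)
  qed
  have prod: "cmod (\<Prod>a\<leftarrow>as. mobius a z0) \<le> \<rho> ^ length as" if "set as \<subseteq> cball 0 r" for as
    using that
  proof (induction as)
    case (Cons a as)
    then show ?case using mob[of a] rho by (auto simp: norm_mult intro!: mult_mono)
  qed simp
  have "b z0 \<noteq> 0" using r z0 by blast
  then obtain N where N: "\<rho> ^ N < cmod (b z0)" using real_arch_pow_inv[of "cmod (b z0)" \<rho>] rho by auto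
  \<comment> \<open>More than \<open>N\<close> factors would force the modulus of
    \<open>b z0\<close> down to \<open>\<rho> ^ N\<close>, since the cofactor has modulus at most
    1.\<close>
  have bound: "n \<le> N" if "P n" for n
  proof (rule ccontr)
    assume "\<not> n \<le> N"
    from \<open>P n\<close> obtain as g where as: "length as = n" "set as \<subseteq> cball 0 r" and
      g: "g holomorphic_on ball 0 1" "((\<lambda>z. cmod (g z)) \<longlongrightarrow> 1) to_circle" and
      eq: "\<And>z. cmod z < 1 \<Longrightarrow> b z = (\<Prod>a\<leftarrow>as. mobius a z) * g z"
      unfolding P_def by blast
    have "cmod (b z0) \<le> \<rho> ^ n * 1"
      unfolding eq[OF z0(2)] norm_mult
      using prod[OF as(2)] as(1) norm_le_1_if_tendsto_1_to_circle[OF g z0(2)] rho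
      by (intro mult_mono) auto
    also have "\<dots> \<le> \<rho> ^ N" using rho \<open>\<not> n \<le> N\<close> by (simp add: power_decreasing)
    finally show False using N by simp
  qed
  obtain n where "P n" and max: "\<And>m. P m \<Longrightarrow> m \<le> n"
    using ex_has_greatest_nat[of P 0 "\<lambda>n. n" "Suc N"] \<open>P 0\<close> bound le_imp_less_Suc by blast
  from \<open>P n\<close> obtain as g where as: "length as = n" "set as \<subseteq> cball 0 r" and
    g: "g holomorphic_on ball 0 1" "((\<lambda>z. cmod (g z)) \<longlongrightarrow> 1) to_circle" and
    eq: "\<And>z. cmod z < 1 \<Longrightarrow> b z = (\<Prod>a\<leftarrow>as. mobius a z) * g z"
    unfolding P_def by blast
  \<comment> \<open>A zero of the cofactor is a zero of \<open>b\<close>, hence lies in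
    \<open>cball 0 r\<close>, and dividing it out contradicts maximality of
    \<open>n\<close>.\<close>
  have nz: "g a \<noteq> 0" if a: "cmod a < 1" for a
  proof
    assume "g a = 0"
    then obtain h where h: "h holomorphic_on ball 0 1" "((\<lambda>z. cmod (h z)) \<longlongrightarrow> 1) to_circle"
      "\<And>z. cmod z < 1 \<Longrightarrow> g z = mobius a z * h z"
      using divide_out_zero[OF g a] by blast
    have "b a = 0" using eq[OF a] \<open>g a = 0\<close> by simp
    then have "a \<in> cball 0 r" using r(3)[OF _ a] by (force simp: not_less)
    then have "P (Suc n)"
      unfolding P_def using as h eq by (intro exI[of _ "a # as"] exI[of _ h]) auto
    then show False using max by fastforce
  qed
  \<comment> \<open>The maximum principle applies to the reciprocal too, so the cofactor is
    unimodular and therefore constant.\<close>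
  have "cmod (inverse (g z)) \<le> 1" if "cmod z < 1" for z
  proof (rule norm_le_1_if_tendsto_1_to_circle[OF _ _ that])
    show "(\<lambda>z. inverse (g z)) holomorphic_on ball 0 1"
      using g(1) nz by (intro holomorphic_intros) auto
    show "((\<lambda>z. cmod (inverse (g z))) \<longlongrightarrow> 1) to_circle"
      using tendsto_inverse[OF g(2)] by (simp add: norm_inverse)
  qed
  then have unimodular: "cmod (g z) = 1" if "cmod z < 1" for z
    using norm_le_1_if_tendsto_1_to_circle[OF g that] nz[OF that] that
    by (fastforce simp: norm_inverse inverse_le_1_iff intro: antisym)
  have "g constant_on ball 0 1"
    using g(1) by (rule maximum_modulus_principle[where U = "ball 0 1" and \<xi> = 0])
      (auto simp: unimodular)
  then obtain c where c: "\<And>z. z \<in> ball 0 1 \<Longrightarrow> g z = c" unfolding constant_on_def by blast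
  have "cmod c = 1" using unimodular[of 0] c[of 0] by simp
  then show ?thesis
    unfolding finite_blaschke_product_def using as(2) r eq c
    by (intro exI[of _ c] exI[of _ as]) (auto simp: mobius_def mult.commute)
qed

section \<open>Normalized kernels near the circle\<close>

context disc_rkhs
begin

text \<open>A contraction \<open>T\<close> with \<open>T\<^sup>* u = cnj \<zeta> u\<close> also satisfies \<open>T u = \<zeta> u\<close>, and multiplication
  by \<open>z\<close> has no eigenfunctions.\<close>

lemma adjoint_Z_no_unimodular_eigenfunction:
  assumes u: "u \<in> elts H" and \<zeta>: "cmod \<zeta> = 1" and eig: "adjoint_op H Z u = (\<lambda>x. cnj \<zeta> * u x)"
  shows "u = (\<lambda>x. 0)"
proof -
  have "inn H (Z u) (\<lambda>x. \<zeta> * u x) = (cnj \<zeta> * \<zeta>) * inn H u u"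
    using inn_adjoint_op[OF bounded_op_Z u u] u eig by simp
  also have "cnj \<zeta> * \<zeta> = 1" using \<zeta> by (simp add: complex_norm_square[symmetric] mult.commute)
  finally have "Re (inn H (Z u) (\<lambda>x. \<zeta> * u x)) = (fnorm H u)\<^sup>2" using u by (simp add: fnorm_power2)
  moreover have "(fnorm H (Z u))\<^sup>2 \<le> (fnorm H u)\<^sup>2"
    using fnorm_Z_le[OF u] u by (intro power_mono) auto
  \<comment> \<open>The square expands to at most \<open>1 - 2 + 1\<close> times the squared norm of
    \<open>u\<close>.\<close>
  ultimately have "(fnorm H (\<lambda>x. Z u x - \<zeta> * u x))\<^sup>2 \<le> 0"
    using u \<zeta> fnorm_scale[OF u, of \<zeta>] by (simp add: fnorm_diff_power2)
  then have zero: "(\<lambda>x. Z u x - \<zeta> * u x) = (\<lambda>x. 0)" using u by (intro fnorm_eq_zero) auto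
  show ?thesis
  proof
    fix x show "u x = 0"
      using fun_cong[OF zero, of x] supported[OF u, of x] \<zeta>
      by (cases "cmod x < 1") (auto simp: mult_op_def)
  qed
qed

text \<open>An element orthogonal to the range is an eigenfunction of the adjoint of
  \<open>Z\<close> with unimodular eigenvalue \<open>cnj \<zeta>\<close>, hence zero.\<close>

lemma range_Z_minus_dense:
  assumes \<zeta>: "cmod \<zeta> = 1" and f: "f \<in> elts H"
  obtains h where "\<And>n. h n \<in> elts H" "converges_in H (\<lambda>n x. Z (h n) x - \<zeta> * h n x) f"
proof -
  define V where "V = (\<lambda>h x. Z h x - \<zeta> * h x) ` elts H"
  obtain v where v: "\<And>n. v n \<in> V" "converges_in H v f"
  proof (rule dense_if_orthogonal_trivial[OF _ _ _ _ _ f, of V])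
    show "V \<subseteq> elts H" by (auto simp: V_def)
    show "(\<lambda>x. 0) \<in> V" unfolding V_def by (rule image_eqI[OF _ zero_mem]) (simp add: mult_op_def)
    show "(\<lambda>x. u x + v x) \<in> V" if "u \<in> V" "v \<in> V" for u v
    proof -
      from that obtain g h where "g \<in> elts H" "h \<in> elts H"
        "u = (\<lambda>x. Z g x - \<zeta> * g x)" "v = (\<lambda>x. Z h x - \<zeta> * h x)" by (auto simp: V_def)
      then show ?thesis unfolding V_def
        by (intro image_eqI[of _ _ "\<lambda>x. g x + h x"]) (auto simp: mult_op_def algebra_simps)
    qed
    show "(\<lambda>x. c * u x) \<in> V" if "u \<in> V" for u c
    proof -
      from that obtain h where "h \<in> elts H" "u = (\<lambda>x. Z h x - \<zeta> * h x)" by (auto simp: V_def)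
      then show ?thesis unfolding V_def
        by (intro image_eqI[of _ _ "\<lambda>x. c * h x"]) (auto simp: mult_op_def algebra_simps)
    qed
    show "u = (\<lambda>x. 0)" if u: "u \<in> elts H" and orth: "\<And>v. v \<in> V \<Longrightarrow> inn H u v = 0" for u
    proof (rule adjoint_Z_no_unimodular_eigenfunction[OF u \<zeta>], rule adjoint_op_eqI)
      fix h assume h: "h \<in> elts H"
      then have "inn H u (\<lambda>x. Z h x - \<zeta> * h x) = 0" by (intro orth) (auto simp: V_def)
      then have "inn H (\<lambda>x. Z h x - \<zeta> * h x) u = 0"
        using inn_commute[of u "\<lambda>x. Z h x - \<zeta> * h x"] u h by simp
      then show "inn H (Z h) u = inn H h (\<lambda>x. cnj \<zeta> * u x)" using u h by simp
    qed (use u in simp)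
  qed blast
  from v(1) have "\<exists>h. h \<in> elts H \<and> v n = (\<lambda>x. Z h x - \<zeta> * h x)" for n by (auto simp: V_def)
  then obtain h where h: "\<And>n. h n \<in> elts H" "\<And>n. v n = (\<lambda>x. Z (h n) x - \<zeta> * h n x)" by metis
  then have "v = (\<lambda>n x. Z (h n) x - \<zeta> * h n x)" by blast
  with v(2) h(1) show ?thesis using that by blast
qed

lemma cmod_eval_le:
  "w \<in> ball 0 1 \<Longrightarrow> f \<in> elts H \<Longrightarrow> cmod (f w) \<le> fnorm H f * fnorm H (kernel_fun w)"
  using Cauchy_Schwarz[of f "kernel_fun w"] by (simp add: inn_kernel_fun)

text \<open>The quotient is the pairing of \<open>f\<close> with the normalized kernel at
  \<open>w n\<close>. On the range of \<open>Z - \<zeta>\<close> it carries the factor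
  \<open>w n - \<zeta>\<close>; density handles general \<open>f\<close>, with an error
  \<open>p\<close> that is uniform in \<open>n\<close>.\<close>

lemma normalized_kernel_weakly_null:
  assumes w: "\<And>n. w n \<in> ball 0 1" and lim: "w \<longlonglongrightarrow> \<zeta>" and \<zeta>: "cmod \<zeta> = 1"
    and pos: "\<And>n. fnorm H (kernel_fun (w n)) > 0" and f: "f \<in> elts H"
  shows "(\<lambda>n. f (w n) / fnorm H (kernel_fun (w n))) \<longlonglongrightarrow> 0"
proof (rule LIMSEQ_I)
  fix e :: real assume "e > 0"
  obtain h where h: "\<And>n. h n \<in> elts H" "converges_in H (\<lambda>n x. Z (h n) x - \<zeta> * h n x) f"
    using range_Z_minus_dense[OF \<zeta> f] by blast
  have "\<forall>\<^sub>F m in sequentially. fnorm H (\<lambda>x. (Z (h m) x - \<zeta> * h m x) - f x) < e / 2"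
    using h(2) \<open>e > 0\<close> unfolding converges_in_def
    by (intro order_tendstoD(2)[of _ 0]) auto
  then obtain m where m: "fnorm H (\<lambda>x. (Z (h m) x - \<zeta> * h m x) - f x) < e / 2"
    by (auto simp: eventually_sequentially)
  define p where "p = (\<lambda>x. (Z (h m) x - \<zeta> * h m x) - f x)"
  have p: "p \<in> elts H" using h f by (simp add: p_def)
  have "(\<lambda>n. cmod (w n - \<zeta>) * fnorm H (h m)) \<longlonglongrightarrow> 0"
    using lim by (intro tendsto_mult_left_zero) (simp add: tendsto_norm_zero LIM_zero)
  then have "\<forall>\<^sub>F n in sequentially. cmod (w n - \<zeta>) * fnorm H (h m) < e / 2"
    using \<open>e > 0\<close> by (intro order_tendstoD(2)[of _ 0]) auto
  then obtain N where N: "\<And>n. n \<ge> N \<Longrightarrow> cmod (w n - \<zeta>) * fnorm H (h m) < e / 2"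
    by (auto simp: eventually_sequentially)
  have "cmod (f (w n) / fnorm H (kernel_fun (w n)) - 0) < e" if "n \<ge> N" for n
  proof -
    let ?K = "fnorm H (kernel_fun (w n))"
    have "f (w n) = (w n - \<zeta>) * h m (w n) - p (w n)"
      by (simp add: p_def mult_op_def algebra_simps)
    then have "cmod (f (w n)) \<le> cmod (w n - \<zeta>) * cmod (h m (w n)) + cmod (p (w n))"
      using norm_triangle_ineq4[of "(w n - \<zeta>) * h m (w n)" "p (w n)"] by (simp add: norm_mult)
    also have "\<dots> \<le> cmod (w n - \<zeta>) * (fnorm H (h m) * ?K) + fnorm H p * ?K"
      using w p h by (intro add_mono mult_left_mono cmod_eval_le) auto
    also have "\<dots> = (cmod (w n - \<zeta>) * fnorm H (h m) + fnorm H p) * ?K" by (simp add: algebra_simps)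
    also have "\<dots> < e * ?K"
      using N[OF that] m pos[of n] unfolding p_def by (intro mult_strict_right_mono) auto
    finally show ?thesis using pos[of n] by (simp add: norm_divide divide_less_eq)
  qed
  then show "\<exists>N. \<forall>n\<ge>N. norm (f (w n) / fnorm H (kernel_fun (w n)) - 0) < e" by blast
qed

end

section \<open>Boundary modulus of the multiplier\<close>

locale disc_sub_rkhs = disc_rkhs H k + sub_rkhs "ball 0 1" H k Hb b
  for H k Hb and b :: "complex \<Rightarrow> complex" +
  assumes diverges: "filterlim (\<lambda>z. Re (k z z)) at_top to_circle"
begin

text \<open>Otherwise choose points tending to the circle where the modulus of \<open>b\<close>
  stays away from 1. For the normalized kernels \<open>u n\<close>, a subsequence of
  \<open>A (u n)\<close> converges in norm, while \<open>u n\<close> is weakly null; so the pairings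
  of \<open>A (u n)\<close> with \<open>u n\<close> tend to 0 along it, although they equal 1 minus
  the squared modulus of \<open>b\<close>.\<close>

lemma norm_b_tendsto_1:
  assumes J: "compact_operator Hb H (\<lambda>f. f)"
  shows "((\<lambda>z. cmod (b z)) \<longlongrightarrow> 1) to_circle"
proof (rule ccontr)
  assume "\<not> ?thesis"
  then obtain e where "e > 0" and e: "\<not> (\<forall>\<^sub>F z in to_circle. dist (cmod (b z)) 1 < e)"
    unfolding tendsto_iff by blast
  \<comment> \<open>Divergence makes the kernel functions nonzero near the circle, so that they can
    be normalized.\<close>
  have "\<forall>\<^sub>F z in to_circle. Re (k z z) > 0"
    using diverges by (simp add: filterlim_at_top_dense)
  then obtain r where r: "r < 1" "\<And>z. r < cmod z \<Longrightarrow> cmod z < 1 \<Longrightarrow> Re (k z z) > 0"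
    unfolding eventually_to_circle by blast
  have "\<exists>z. max r (1 - inverse (real (Suc n))) < cmod z \<and> cmod z < 1 \<and> \<not> dist (cmod (b z)) 1 < e" for n
  proof (rule ccontr)
    assume none: "\<not> ?thesis"
    have "\<forall>\<^sub>F z in to_circle. dist (cmod (b z)) 1 < e"
      unfolding eventually_to_circle
      by (rule exI[of _ "max (max r (1 - inverse (real (Suc n)))) (1/2)"]) (use none r(1) in auto)
    then show False using e by blast
  qed
  then obtain w' where w': "\<And>n. max r (1 - inverse (real (Suc n))) < cmod (w' n)"
    "\<And>n. cmod (w' n) < 1" "\<And>n. \<not> dist (cmod (b (w' n))) 1 < e" by metis
  have "(\<lambda>n. cmod (w' n)) \<longlonglongrightarrow> 1"
  proof (rule tendsto_sandwich)
    show "(\<lambda>n. 1 - inverse (real (Suc n))) \<longlonglongrightarrow> 1"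
      using tendsto_diff[OF tendsto_const LIMSEQ_inverse_real_of_nat, of 1] by simp
  qed (use w' in \<open>auto intro!: always_eventually less_imp_le\<close>)
  moreover have "\<forall>n. w' n \<in> cball 0 1" using w'(2) by (simp add: less_imp_le)
  then obtain \<zeta> s where s: "strict_mono (s :: nat \<Rightarrow> nat)" "(w' \<circ> s) \<longlonglongrightarrow> \<zeta>"
    using compact_imp_seq_compact[OF compact_cball] unfolding seq_compact_def by metis
  ultimately have \<zeta>: "cmod \<zeta> = 1"
    using LIMSEQ_unique[OF tendsto_norm[OF s(2)], of 1]
      LIMSEQ_subseq_LIMSEQ[of "\<lambda>n. cmod (w' n)" 1 s] by (simp add: o_def)
  define w where "w = w' \<circ> s"
  define K where "K n = fnorm H (kernel_fun (w n))" for n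
  have w: "w n \<in> ball 0 1" for n using w' by (simp add: w_def)
  have K_pos: "K n > 0" for n
  proof -
    have "0 < Re (k (w n) (w n))" using w'[of "s n"] by (intro r(2)) (auto simp: w_def)
    then have "K n \<noteq> 0" using fnorm_kernel_fun_power2[OF w, of n] by (auto simp: K_def)
    then show ?thesis using fnorm_nonneg[OF kernel_fun_mem[OF w]] by (simp add: K_def less_le)
  qed
  define u where "u n = (\<lambda>x. (1 / of_real (K n)) * kernel_fun (w n) x)" for n
  have u: "u n \<in> elts H" for n unfolding u_def by (intro scale_mem kernel_fun_mem w)
  have u_norm: "fnorm H (u n) = 1" for n
    unfolding u_def fnorm_scale[OF kernel_fun_mem[OF w]] K_def[symmetric] using K_pos[of n]
    by (simp add: norm_divide)
  have "A (u n) \<in> elts Hb \<and> fnorm Hb (A (u n)) \<le> 1" for n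
  proof -
    have "(fnorm Hb (A (u n)))\<^sup>2 \<le> 1\<^sup>2"
      using fnorm_Hb_A_power2[OF u, of n] defect_le[OF u, of n] u_norm[of n] by simp
    then have "fnorm Hb (A (u n)) \<le> 1" by (rule power2_le_imp_le) simp
    then show ?thesis using u by simp
  qed
  then obtain t g where t: "strict_mono (t :: nat \<Rightarrow> nat)" and conv: "converges_in H (\<lambda>n. A (u (t n))) g"
    using J[unfolded compact_operator_def, THEN conjunct2, rule_format, of "\<lambda>n. A (u n)" 1] by blast
  then have g: "g \<in> elts H" and lim: "(\<lambda>n. fnorm H (\<lambda>x. A (u (t n)) x - g x)) \<longlonglongrightarrow> 0"
    by (auto simp: converges_in_def)
  \<comment> \<open>The left side is the pairing of \<open>A (u n)\<close> with \<open>u n\<close>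
    in \<open>H\<close>.\<close>
  have eval: "A (u n) (w n) / K n = of_real (1 - (cmod (b (w n)))\<^sup>2)" for n
  proof -
    have "A (u n) (w n) = (1 / of_real (K n)) * Hb.kernel_fun (w n) (w n)"
      unfolding u_def A_scale[OF kernel_fun_mem[OF w]] A_kernel_fun[OF w] ..
    also have "Hb.kernel_fun (w n) (w n) = kernel_fun (w n) (w n) * of_real (1 - (cmod (b (w n)))\<^sup>2)"
      unfolding of_real_diff complex_norm_square using w by (simp add: Hb.kernel_fun_def kernel_fun_def)
    also have "kernel_fun (w n) (w n) = of_real ((K n)\<^sup>2)"
      using inn_kernel_fun[OF w kernel_fun_mem[OF w], of n n] inn_self[OF kernel_fun_mem[OF w], of n]
      by (simp add: K_def)
    finally show ?thesis using K_pos[of n] by (simp add: power2_eq_square)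
  qed
  have "(\<lambda>n. g (w n) / K n) \<longlonglongrightarrow> 0"
    unfolding K_def
    by (rule normalized_kernel_weakly_null[OF w s(2)[folded w_def] \<zeta> K_pos[unfolded K_def] g])
  then have gt: "(\<lambda>n. cmod (g (w (t n)) / K (t n))) \<longlonglongrightarrow> 0"
    using LIMSEQ_subseq_LIMSEQ[OF _ t] tendsto_norm_zero by (fastforce simp: o_def)
  have bound: "\<bar>1 - (cmod (b (w (t n))))\<^sup>2\<bar> \<le> fnorm H (\<lambda>x. A (u (t n)) x - g x) + cmod (g (w (t n)) / K (t n))" for n
  proof -
    let ?n = "t n"
    have "\<bar>1 - (cmod (b (w ?n)))\<^sup>2\<bar> = cmod (A (u ?n) (w ?n) / K ?n)" unfolding eval norm_of_real ..
    also have "A (u ?n) (w ?n) / K ?n = (A (u ?n) (w ?n) - g (w ?n)) / K ?n + g (w ?n) / K ?n"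
      by (simp add: diff_divide_distrib)
    also have "cmod \<dots> \<le> cmod ((A (u ?n) (w ?n) - g (w ?n)) / K ?n) + cmod (g (w ?n) / K ?n)"
      by (rule norm_triangle_ineq)
    also have "cmod ((A (u ?n) (w ?n) - g (w ?n)) / K ?n) \<le> fnorm H (\<lambda>x. A (u ?n) x - g x)"
      using cmod_eval_le[OF w, of "\<lambda>x. A (u ?n) x - g x" ?n] u g K_pos[of ?n]
      by (simp add: norm_divide divide_le_eq K_def)
    finally show ?thesis by simp
  qed
  have "(\<lambda>n. 1 - (cmod (b (w (t n))))\<^sup>2) \<longlonglongrightarrow> 0"
  proof (rule Lim_null_comparison)
    show "(\<lambda>n. fnorm H (\<lambda>x. A (u (t n)) x - g x) + cmod (g (w (t n)) / K (t n))) \<longlonglongrightarrow> 0"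
      using tendsto_add[OF lim gt] by simp
  qed (use bound in simp)
  from tendsto_diff[OF tendsto_const this, of 1]
  have "(\<lambda>n. (cmod (b (w (t n))))\<^sup>2) \<longlonglongrightarrow> 1" by simp
  from tendsto_real_sqrt[OF this] have "(\<lambda>n. cmod (b (w (t n)))) \<longlonglongrightarrow> 1" by simp
  then have "\<forall>\<^sub>F n in sequentially. dist (cmod (b (w (t n)))) 1 < e" using \<open>e > 0\<close> by (rule tendstoD)
  then show False using w'(3) by (auto simp: eventually_sequentially w_def)
qed

text \<open>An empty list of zeros would make \<open>b\<close> constant on the disc, so at least one
  Moebius factor is available.\<close>

lemma finite_blaschke_product_cases:
  assumes "finite_blaschke_product b" and "\<not> b constant_on ball 0 1"
  obtains c a as where "cmod c = 1" "set (a # as) \<subseteq> ball 0 1"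
    "defect H (mult_op b) = defect H (mult_op (blaschke c (a # as)))"
proof -
  obtain c as where c: "cmod c = 1" "set as \<subseteq> ball 0 1"
    and eq: "\<And>z. z \<in> ball 0 1 \<Longrightarrow> b z = blaschke c as z"
    using assms(1) unfolding finite_blaschke_product_def blaschke_def mobius_def by blast
  have "as \<noteq> []"
  proof
    assume "as = []"
    then have "b constant_on ball 0 1" using eq by (auto simp: constant_on_def blaschke_def)
    then show False using assms(2) by blast
  qed
  then obtain a as' where "as = a # as'" by (cases as) auto
  moreover have "defect H (mult_op b) = defect H (mult_op (blaschke c as))"
    using eq by (rule defect_cong_on_disc)
  ultimately show ?thesis using that[of c a as'] c by simp
qed

end

theorem theorem4:
  fixes H Hb :: "complex fun_space"
    and k :: "complex \<Rightarrow> complex \<Rightarrow> complex"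
    and b :: "complex \<Rightarrow> complex"
  assumes "rkhs (ball 0 1) H k"
    and "\<forall>f\<in>elts H. f holomorphic_on ball 0 1"
    and "(\<lambda>z. z) \<in> Mult H" and "contractive_on H (mult_op (\<lambda>z. z))"
    and "filterlim (\<lambda>z. Re (k z z)) at_top (filtercomap cmod (at_left 1))"
    and "b \<in> Mult H" and "contractive_on H (mult_op b)"
    and "b holomorphic_on ball 0 1" and "\<not> b constant_on ball 0 1"
    and "rkhs (ball 0 1) Hb (\<lambda>z w. k z w * (1 - b z * cnj (b w)))"
  shows "compact_operator Hb H (\<lambda>f. f) \<longleftrightarrow>
    compact_operator H H
      (\<lambda>f z. f z - mult_op (\<lambda>z. z) (adjoint_op H (mult_op (\<lambda>z. z)) f) z) \<and>
    finite_blaschke_product b"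
proof -
  interpret H: rkhs "ball 0 1" H k by fact
  interpret Hb: rkhs "ball 0 1" Hb "\<lambda>z w. k z w * (1 - b z * cnj (b w))" by fact
  interpret disc_sub_rkhs H k Hb b
    by unfold_locales (fact assms)+
  have Z: "compact_operator H H (\<lambda>f z. f z - Z (adjoint_op H Z f) z) \<longleftrightarrow> compact_form H (defect H Z)"
    by (rule H.compact_operator_defect_iff[OF bounded_op_Z id_contractive])
  show ?thesis
    unfolding Z compact_inclusion_iff
  proof
    assume q: "compact_form H (defect H (mult_op b))"
    then have "((\<lambda>z. cmod (b z)) \<longlongrightarrow> 1) to_circle"
      unfolding compact_inclusion_iff[symmetric] by (rule norm_b_tendsto_1)
    \<comment> \<open>Holomorphy of \<open>b\<close> enters here, through the maximum
      principle.\<close>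
    with assms(8) have "finite_blaschke_product b"
      by (rule finite_blaschke_product_if_tendsto_1_to_circle)
    moreover from this assms(9) obtain c a as where "cmod c = 1" "set (a # as) \<subseteq> ball 0 1"
      "defect H (mult_op b) = defect H (mult_op (blaschke c (a # as)))"
      by (rule finite_blaschke_product_cases)
    then have "compact_form H (defect H Z)"
      using compact_form_Z_if_blaschke q by simp
    ultimately show "compact_form H (defect H Z) \<and> finite_blaschke_product b" by blast
  next
    assume "compact_form H (defect H Z) \<and> finite_blaschke_product b"
    moreover from this assms(9) obtain c a as where "cmod c = 1" "set (a # as) \<subseteq> ball 0 1"
      "defect H (mult_op b) = defect H (mult_op (blaschke c (a # as)))"
      using finite_blaschke_product_cases by blast
    ultimately show "compact_form H (defect H (mult_op b))"
      using compact_form_blaschke by simp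
  qed
qed

end
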